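(* Let $C\subset M$ be any adapted box. Then $$\varlimsup_{y\to 0^+}\Big[\,|m_y(C)-\overline m(C)|\,y^{-\alpha}\Big]=+\infty$$ for all $\alpha>1/2$.
   Context: Let $\mathbb H=\{x+iy: y>0\}$ be the upper half-plane with the hyperbolic metric $(dx^2+dy^2)/y^2$, and let $T_1\mathbb H$ be its unit tangent bundle. A unit tangent vector is written $(z,\theta)$, where $z=x+iy\in\mathbb H$ is the base point and $\theta\in\mathbb R/2\pi\mathbb Z$ is its angle measured counter-clockwise from the upward vertical direction. The group $\mathrm{PSL}(2,\mathbb R)$ acts simply transitively on $T_1\mathbb H$ by differentials of Möbius transformations: for $\sigma(z)=\frac{az+b}{cz+d}$, $\sigma(z,\theta)=(\sigma(z),\theta-2\arg(cz+d))$. $M=\mathrm{PSL}(2,\mathbb R)/\mathrm{PSL}(2,\mathbb Z)$ is identified with the quotient of $T_1\mathbb H$ by this action of $\mathrm{PSL}(2,\mathbb Z)$, with projection $P:T_1\mathbb H\to M$. $\overline m$ is the normalized Haar measure on $M$, i.e. the probability measure on $M$ proportional to the one induced by $y^{-2}\,dx\,dy\,d\theta$ on $T_1\mathbb H$. For $y>0$, $m_y$ is the Borel probability measure on $M$ uniformly distributed (with respect to arc length) on the closed unstable horocycle orbit of period $1/y$, which is $P(\{((x,y),\pi): 0\le x\le 1\})$; that is, $m_y(f)=\int_0^1 f(P((x,y),\pi))\,dx$. The unstable horocycle flow $h^+_s$ on $T_1\mathbb H$ is the flow commuting with the action of $\mathrm{PSL}(2,\mathbb R)$ and satisfying $h^+_s((x,y),\pi)=((x+sy,y),\pi)$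 (so it moves a unit vector at unit speed along the horocycle orthogonal to it and based at the backward endpoint of its geodesic). The basic stable leaf is $L^-=\{(x+iy,0)\}\subset T_1\mathbb H$. An adapted box in $M$ is a set $C=P(\widetilde C)$ with $\widetilde C=\{h^+_s(x+iy,0): \alpha_1\le x\le\alpha_2,\ \beta_1\le y\le\beta_2,\ |s|\le \ell/2\}$ for some $0<\alpha_1<\alpha_2\le 1$, $0<\beta_1<\beta_2$, $\ell>0$, such that $P$ is injective on $\widetilde C$ (the box is embedded). The rectangle $Q=[\alpha_1,\alpha_2]\times[\beta_1,\beta_2]$ (viewed in $L^-$ and projected to $M$) is the base of $C$ and $\ell$ its height. *)

theory Defs
  imports "HOL-Analysis.Analysis"
begin

section \<open>The unit tangent bundle of the upper half-plane\<close>

text \<open>An angle in \<open>\<real>/2\<pi>\<int>\<close> is represented by the point \<open>cis \<theta>\<close> of the unit circle, so that the unit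
  tangent vector \<open>(z, \<theta>)\<close> is the pair \<open>(z, cis \<theta>)\<close>; see \<open>T1H_eq\<close>.\<close>

definition tvec :: "complex \<Rightarrow> real \<Rightarrow> complex \<times> complex" where
  "tvec z \<theta> = (z, cis \<theta>)"

definition T1H :: "(complex \<times> complex) set" where
  "T1H = {(z, u). Im z > 0 \<and> norm u = 1}"

definition SL2R :: "(real^2^2) set" where
  "SL2R = {A. det A = 1}"

definition SL2Z :: "(real^2^2) set" where
  "SL2Z = {A \<in> SL2R. \<forall>i j. A $ i $ j \<in> \<int>}"

definition mob_denom :: "real^2^2 \<Rightarrow> complex \<Rightarrow> complex" where
  "mob_denom A z = of_real (A $ 2 $ 1) * z + of_real (A $ 2 $ 2)"

definition mob :: "real^2^2 \<Rightarrow> complex \<Rightarrow> complex" where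
  "mob A z = (of_real (A $ 1 $ 1) * z + of_real (A $ 1 $ 2)) / mob_denom A z"

text \<open>The action \<open>(z, \<theta>) \<mapsto> (\<sigma> z, \<theta> - 2 arg (c z + d))\<close>.  The matrices \<open>A\<close> and \<open>- A\<close> act in the same
  way, so \<open>SL(2)\<close> and \<open>PSL(2)\<close> have the same orbits.\<close>

definition act :: "real^2^2 \<Rightarrow> complex \<times> complex \<Rightarrow> complex \<times> complex" where
  "act A v = (mob A (fst v), snd v * cis (- 2 * Arg (mob_denom A (fst v))))"

text \<open>The unstable horocycle flow: a tangent vector \<open>v\<close> is written as \<open>\<sigma> ((x, y), \<pi>)\<close>, and is moved
  to \<open>\<sigma> ((x + s y, y), \<pi>)\<close>.  The lemmas \<open>hplus_pi\<close> and \<open>hplus_act\<close> below show that this is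
  well-defined and gives the flow that commutes with the action.\<close>

definition hplus :: "real \<Rightarrow> complex \<times> complex \<Rightarrow> complex \<times> complex" where
  "hplus s v = (THE w. \<exists>A\<in>SL2R. \<exists>x y. y > 0 \<and>
     v = act A (tvec (Complex x y) pi) \<and> w = act A (tvec (Complex (x + s * y) y) pi))"


section \<open>The quotient by the modular group\<close>

definition proj :: "complex \<times> complex \<Rightarrow> (complex \<times> complex) set" where
  "proj v = (\<lambda>A. act A v) ` SL2Z"

definition M_space :: "(complex \<times> complex) set set" where
  "M_space = proj ` T1H"

text \<open>The Borel sets of the quotient topology.\<close>

definition borel_M :: "(complex \<times> complex) set measure" where
  "borel_M = sigma M_space
     {U. U \<subseteq> M_space \<and> openin (top_of_set T1H) {v \<in> T1H. proj v \<in> U}}"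

definition circle_measure :: "complex measure" where
  "circle_measure = distr (restrict_space lborel {0..<2*pi}) borel cis"

text \<open>The measure \<open>y\<^sup>-\<^sup>2 dx dy d\<theta>\<close> on \<open>T1H\<close>.\<close>

definition liouville :: "(complex \<times> complex) measure" where
  "liouville = restrict_space
     (density lborel (\<lambda>z. ennreal (1 / (Im z)\<^sup>2)) \<Otimes>\<^sub>M circle_measure) T1H"

text \<open>The unit tangent vectors based in the standard fundamental domain of the modular group on the
  upper half-plane.  This is a fundamental domain (up to the null set lying above its boundary) for
  the action on \<open>T1H\<close>, so the measure that \<open>liouville\<close> induces on the quotient is the image of its
  restriction to this set; \<open>haar_M\<close> is this image normalized to total mass \<open>1\<close>.\<close>

definition fund_domain :: "(complex \<times> complex) set" where
  "fund_domain = {(z, u) \<in> T1H. \<bar>Re z\<bar> \<le> 1/2 \<and> norm z \<ge> 1}"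

definition haar_M :: "(complex \<times> complex) set measure" where
  "haar_M = distr (uniform_measure liouville fund_domain) borel_M proj"

text \<open>The closed horocycle of period \<open>1/y\<close> with its normalized arc length (for \<open>y > 0\<close>).\<close>

definition horocycle_measure :: "real \<Rightarrow> (complex \<times> complex) set measure" where
  "horocycle_measure y =
     distr (uniform_measure lborel {0..1}) borel_M (\<lambda>x. proj (tvec (Complex x y) pi))"


section \<open>Adapted boxes\<close>

definition box_lift :: "real \<Rightarrow> real \<Rightarrow> real \<Rightarrow> real \<Rightarrow> real \<Rightarrow> (complex \<times> complex) set" where
  "box_lift \<alpha>1 \<alpha>2 \<beta>1 \<beta>2 l = {hplus s (tvec (Complex x y) 0) | s x y.
     \<alpha>1 \<le> x \<and> x \<le> \<alpha>2 \<and> \<beta>1 \<le> y \<and> y \<le> \<beta>2 \<and> \<bar>s\<bar> \<le> l / 2}"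

definition adapted_box :: "(complex \<times> complex) set set \<Rightarrow> bool" where
  "adapted_box C \<longleftrightarrow> (\<exists>\<alpha>1 \<alpha>2 \<beta>1 \<beta>2 l.
     0 < \<alpha>1 \<and> \<alpha>1 < \<alpha>2 \<and> \<alpha>2 \<le> 1 \<and> 0 < \<beta>1 \<and> \<beta>1 < \<beta>2 \<and> l > 0 \<and>
     inj_on proj (box_lift \<alpha>1 \<alpha>2 \<beta>1 \<beta>2 l) \<and> C = proj ` box_lift \<alpha>1 \<alpha>2 \<beta>1 \<beta>2 l)"


section \<open>Basic facts\<close>

lemma T1H_eq: "T1H = {tvec z \<theta> | z \<theta>. Im z > 0}"
proof -
  have "\<exists>\<theta>. u = cis \<theta>" if "norm u = 1" for u :: complex
    using that by (metis rcis_cmod_Arg rcis_def mult_1 of_real_1)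
  then show ?thesis
    by (fastforce simp: T1H_def tvec_def)
qed

lemma cis_Arg_sq: "w \<noteq> 0 \<Longrightarrow> cis (- 2 * Arg w) = cnj w / w"
proof -
  assume w: "w \<noteq> 0"
  have "cis (- 2 * Arg w) = inverse (cis (Arg w) * cis (Arg w))"
    by (simp add: cis_mult flip: cis_inverse)
  also have "\<dots> = (of_real (norm w))\<^sup>2 / (w * w)"
    using w by (simp add: cis_Arg sgn_eq power2_eq_square)
  also have "\<dots> = cnj w / w"
    using w by (simp add: complex_norm_square del: of_real_power flip: of_real_power)
  finally show ?thesis .
qed

lemma SL2R_det: "A \<in> SL2R \<Longrightarrow> A$1$1 * A$2$2 - A$1$2 * A$2$1 = 1"
  by (simp add: SL2R_def det_2)

lemma mob_denom_nz:
  assumes "A \<in> SL2R" "Im z > 0"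
  shows "mob_denom A z \<noteq> 0"
proof
  assume "mob_denom A z = 0"
  then have "A$2$1 * Im z = 0" "A$2$1 * Re z + A$2$2 = 0"
    by (simp_all add: mob_denom_def complex_eq_iff)
  with assms SL2R_det[OF assms(1)] show False by simp
qed

lemma act_eq:
  assumes "A \<in> SL2R" "Im z > 0"
  shows "act A (z, u) = (mob A z, u * (cnj (mob_denom A z) / mob_denom A z))"
  using cis_Arg_sq[OF mob_denom_nz[OF assms]] by (simp add: act_def)

lemma Im_mob:
  assumes "A \<in> SL2R" "Im z > 0"
  shows "Im (mob A z) = Im z / (norm (mob_denom A z))\<^sup>2"
proof -
  have "Im (mob A z) = (A$1$1 * A$2$2 - A$1$2 * A$2$1) * Im z / (norm (mob_denom A z))\<^sup>2"
    by (simp add: mob_def Im_divide mob_denom_def cmod_power2 algebra_simps)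
  then show ?thesis using SL2R_det[OF assms(1)] by simp
qed

lemma act_T1H:
  assumes "A \<in> SL2R" "v \<in> T1H"
  shows "act A v \<in> T1H"
proof -
  obtain z u where v: "v = (z, u)" "Im z > 0" "norm u = 1"
    using assms(2) by (auto simp: T1H_def)
  then show ?thesis
    using mob_denom_nz[OF assms(1) v(2)] Im_mob[OF assms(1) v(2)]
    by (simp add: T1H_def act_def norm_mult)
qed

lemma SL2R_mult: "A \<in> SL2R \<Longrightarrow> B \<in> SL2R \<Longrightarrow> A ** B \<in> SL2R"
  by (simp add: SL2R_def det_mul)

lemma act_mult:
  assumes "A \<in> SL2R" "B \<in> SL2R" "v \<in> T1H"
  shows "act (A ** B) v = act A (act B v)"
proof -
  obtain z u where v: "v = (z, u)" "Im z > 0" "norm u = 1"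
    using assms(3) by (auto simp: T1H_def)
  have nz: "mob_denom B z \<noteq> 0" using mob_denom_nz assms v by blast
  have pos: "Im (mob B z) > 0" using act_T1H[OF assms(2,3)] v by (simp add: T1H_def act_def)
  have nz2: "mob_denom A (mob B z) \<noteq> 0" using mob_denom_nz assms pos by blast
  have d: "mob_denom (A ** B) z = mob_denom A (mob B z) * mob_denom B z"
    using nz by (simp add: mob_def mob_denom_def matrix_matrix_mult_def sum_2 field_simps)
  have "mob (A ** B) z * mob_denom (A ** B) z = mob A (mob B z) * mob_denom (A ** B) z"
    using nz nz2 mob_denom_nz[OF SL2R_mult[OF assms(1,2)] v(2)]
    unfolding d
    by (simp add: mob_def[of "A ** B"] d mob_def[of A])
       (simp add: mob_def mob_denom_def matrix_matrix_mult_def sum_2 field_simps)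
  then have m: "mob (A ** B) z = mob A (mob B z)"
    using mob_denom_nz[OF SL2R_mult[OF assms(1,2)] v(2)] by simp
  show ?thesis
    unfolding v(1) act_eq[OF SL2R_mult[OF assms(1,2)] v(2)] act_eq[OF assms(2) v(2)]
      act_eq[OF assms(1) pos] m d by (simp add: mult_ac)
qed

lemma SL2R_one: "mat 1 \<in> SL2R"
  by (simp add: SL2R_def)

lemma act_one: "act (mat 1) v = v"
  by (simp add: act_def mob_def mob_denom_def mat_def)

lemma SL2R_inv:
  assumes "A \<in> SL2R"
  obtains B where "B \<in> SL2R" "B ** A = mat 1" "A ** B = mat 1"
proof -
  have "invertible A" using assms by (simp add: SL2R_def invertible_det_nz)
  then obtain B where B: "A ** B = mat 1" "B ** A = mat 1" by (auto simp: invertible_def)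
  then have "det A * det B = 1" by (metis det_I det_mul)
  with assms B that[of B] show ?thesis by (simp add: SL2R_def)
qed

lemma act_transitive:
  assumes "v \<in> T1H"
  obtains A x y where "A \<in> SL2R" "y > 0" "v = act A (tvec (Complex x y) pi)"
proof -
  obtain z \<theta> where v: "v = tvec z \<theta>" "Im z > 0" using assms by (auto simp: T1H_eq)
  define t where "t = (pi - \<theta>) / 2"
  define A :: "real^2^2" where
    "A = (\<chi> i j. if i = 1 then (if j = 1 then cos t else - sin t)
                 else (if j = 1 then sin t else cos t))"
  have A: "A$1$1 = cos t" "A$1$2 = - sin t" "A$2$1 = sin t" "A$2$2 = cos t"
    by (simp_all add: A_def)
  have AS: "A \<in> SL2R" by (simp add: SL2R_def det_2 A power2_eq_square[symmetric])
  define B :: "real^2^2" where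
    "B = (\<chi> i j. if i = 1 then (if j = 1 then sqrt (Im z) else Re z / sqrt (Im z))
                 else (if j = 1 then 0 else 1 / sqrt (Im z)))"
  have B: "B$1$1 = sqrt (Im z)" "B$1$2 = Re z / sqrt (Im z)" "B$2$1 = 0" "B$2$2 = 1 / sqrt (Im z)"
    by (simp_all add: B_def)
  have BS: "B \<in> SL2R" using v by (simp add: SL2R_def det_2 B)
  have dA: "mob_denom A \<i> = cis t"
    by (simp add: mob_denom_def A complex_eq_iff)
  have "of_real (A$1$1) * \<i> + of_real (A$1$2) = \<i> * cis t"
    by (simp add: A complex_eq_iff)
  then have mA: "mob A \<i> = \<i>"
    by (simp add: mob_def dA)
  have a1: "act A (\<i>, -1) = (\<i>, cis \<theta>)"
  proof -
    have "cis (- t) / cis t = cis (\<theta> - pi)"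
      unfolding cis_divide by (simp add: t_def)
    moreover have "- cis (\<theta> - pi) = cis \<theta>" by (simp add: complex_eq_iff cos_diff sin_diff)
    ultimately show ?thesis
      using act_eq[OF AS, of "\<i>" "-1"] by (simp add: dA mA cis_cnj)
  qed
  have dB: "mob_denom B \<i> = of_real (1 / sqrt (Im z))"
    by (simp add: mob_denom_def B)
  have "sqrt (Im z) * sqrt (Im z) = Im z" using v by simp
  then have mB: "mob B \<i> = z"
    unfolding mob_def dB using v by (simp add: B complex_eq_iff field_simps)
  have "act B (\<i>, cis \<theta>) = v"
    using act_eq[OF BS, of "\<i>" "cis \<theta>"] v by (simp add: dB mB tvec_def)
  moreover have "(\<i>, -1) \<in> T1H" by (simp add: T1H_def)
  ultimately have "act (B ** A) (\<i>, -1) = v"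
    using act_mult[OF BS AS, of "(\<i>, -1)"] a1 by simp
  then show ?thesis
    using that[of "B ** A" 1 0] SL2R_mult[OF BS AS] by (simp add: tvec_def imaginary_unit.code)
qed

lemma act_tvec_pi_fixes:
  assumes "A \<in> SL2R" "y > 0" "y' > 0"
    and eq: "act A (tvec (Complex x y) pi) = tvec (Complex x' y') pi"
  shows "act A (tvec (Complex (x + s * y) y) pi) = tvec (Complex (x' + s * y') y') pi"
proof -
  let ?w = "mob_denom A (Complex x y)"
  have nz: "?w \<noteq> 0" using mob_denom_nz assms by simp
  have e: "mob A (Complex x y) = Complex x' y'" "cnj ?w / ?w = 1"
    using eq act_eq[OF assms(1), of "Complex x y" "-1"] assms(2) by (simp_all add: tvec_def)
  then have "cnj ?w = ?w" using nz by simp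
  then have "Im ?w = 0" by (simp add: complex_eq_iff)
  then have c: "A$2$1 = 0" using assms(2) by (simp add: mob_denom_def)
  then have ad: "A$1$1 * A$2$2 = 1" using SL2R_det[OF assms(1)] by simp
  then have dn: "A$2$2 \<noteq> 0" by auto
  have mob: "mob A z = Complex ((A$1$1 * Re z + A$1$2) / A$2$2) (A$1$1 * Im z / A$2$2)" for z
    using dn by (simp add: mob_def mob_denom_def c complex_eq_iff)
  have x': "x' = (A$1$1 * x + A$1$2) / A$2$2" "y' = A$1$1 * y / A$2$2"
    using e(1) by (simp_all add: mob)
  have "mob A (Complex (x + s * y) y) = Complex (x' + s * y') y'"
    unfolding mob x' using dn by (simp add: field_simps)
  moreover have "mob_denom A (Complex (x + s * y) y) = of_real (A$2$2)"
    by (simp add: mob_denom_def c)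
  ultimately show ?thesis
    using act_eq[OF assms(1), of "Complex (x + s * y) y" "-1"] assms(2) dn by (simp add: tvec_def)
qed

lemma tvec_T1H: "y > 0 \<Longrightarrow> tvec (Complex x y) \<theta> \<in> T1H"
  by (simp add: tvec_def T1H_def)

lemma hplus_act_pi:
  assumes "A \<in> SL2R" "y > 0"
  shows "hplus s (act A (tvec (Complex x y) pi)) = act A (tvec (Complex (x + s * y) y) pi)"
  unfolding hplus_def
proof (rule the_equality)
  fix w
  assume "\<exists>A'\<in>SL2R. \<exists>x' y'. y' > 0 \<and>
     act A (tvec (Complex x y) pi) = act A' (tvec (Complex x' y') pi) \<and>
     w = act A' (tvec (Complex (x' + s * y') y') pi)"
  then obtain A' x' y' where A': "A' \<in> SL2R" "y' > 0"
    and eq: "act A (tvec (Complex x y) pi) = act A' (tvec (Complex x' y') pi)"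
    and w: "w = act A' (tvec (Complex (x' + s * y') y') pi)" by blast
  obtain B where B: "B \<in> SL2R" "B ** A = mat 1" "A ** B = mat 1" using SL2R_inv[OF assms(1)] .
  have "act (B ** A') (tvec (Complex x' y') pi) = act B (act A (tvec (Complex x y) pi))"
    by (simp add: act_mult B A' tvec_T1H eq)
  also have "\<dots> = tvec (Complex x y) pi"
    by (simp add: B assms tvec_T1H act_one flip: act_mult)
  finally have "act (B ** A') (tvec (Complex (x' + s * y') y') pi) = tvec (Complex (x + s * y) y) pi"
    using act_tvec_pi_fixes SL2R_mult[OF B(1) A'(1)] A' assms by blast
  then have "act A (tvec (Complex (x + s * y) y) pi) = act A (act B w)"
    by (simp add: w act_mult B A' tvec_T1H)
  also have "\<dots> = w"
    using act_T1H[OF A'(1) tvec_T1H[OF A'(2)]] by (simp add: w B assms act_one flip: act_mult)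
  finally show "w = act A (tvec (Complex (x + s * y) y) pi)" by simp
qed (use assms in blast)

lemma hplus_pi: "y > 0 \<Longrightarrow> hplus s (tvec (Complex x y) pi) = tvec (Complex (x + s * y) y) pi"
  using hplus_act_pi[OF SL2R_one] by (simp add: act_one)

lemma hplus_act:
  assumes "A \<in> SL2R" "v \<in> T1H"
  shows "hplus s (act A v) = act A (hplus s v)"
proof -
  obtain B x y where B: "B \<in> SL2R" "y > 0" "v = act B (tvec (Complex x y) pi)"
    using act_transitive[OF assms(2)] .
  then have "hplus s (act A v) = hplus s (act (A ** B) (tvec (Complex x y) pi))"
    by (simp add: act_mult assms tvec_T1H)
  also have "\<dots> = act A (act B (tvec (Complex (x + s * y) y) pi))"
    using hplus_act_pi[OF SL2R_mult[OF assms(1) B(1)] B(2)]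
    by (simp add: act_mult assms B(1,2) tvec_T1H)
  finally show ?thesis by (simp add: B hplus_act_pi)
qed

lemma sets_liouville: "sets liouville = sets (restrict_space borel T1H)"
  unfolding liouville_def
  by (rule sets_restrict_space_cong)
     (simp add: borel_prod[symmetric] circle_measure_def cong: sets_pair_measure_cong)

lemma proj_measurable: "proj \<in> restrict_space borel T1H \<rightarrow>\<^sub>M borel_M"
  unfolding borel_M_def
proof (rule measurable_measure_of)
  fix U assume "U \<in> {U. U \<subseteq> M_space \<and> openin (top_of_set T1H) {v \<in> T1H. proj v \<in> U}}"
  then obtain V where "open V" "{v \<in> T1H. proj v \<in> U} = T1H \<inter> V"
    by (auto simp: openin_open)
  moreover have "proj -` U \<inter> T1H = {v \<in> T1H. proj v \<in> U}" by auto
  ultimately show "proj -` U \<inter> space (restrict_space borel T1H) \<in> sets (restrict_space borel T1H)"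
    by (auto simp: space_restrict_space sets_restrict_space)
qed (auto simp: M_space_def space_restrict_space)

lemma proj_tvec_measurable:
  assumes "y > 0"
  shows "(\<lambda>x. proj (tvec (Complex x y) \<theta>)) \<in> borel \<rightarrow>\<^sub>M borel_M"
proof -
  have "(\<lambda>x. tvec (Complex x y) \<theta>) \<in> borel \<rightarrow>\<^sub>M borel"
    unfolding tvec_def Complex_eq by (intro borel_measurable_continuous_onI continuous_intros)
  then have "(\<lambda>x. tvec (Complex x y) \<theta>) \<in> borel \<rightarrow>\<^sub>M restrict_space borel T1H"
    by (rule measurable_restrict_space2[rotated]) (use assms tvec_T1H in auto)
  from measurable_compose[OF this proj_measurable] show ?thesis .
qed

lemma emeasure_horocycle_measure:
  assumes "y > 0"
  shows "emeasure (horocycle_measure y) (space (horocycle_measure y)) = 1"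
proof -
  let ?f = "\<lambda>x. proj (tvec (Complex x y) pi)"
  have m: "?f \<in> uniform_measure lborel {0..1} \<rightarrow>\<^sub>M borel_M"
    using proj_tvec_measurable[OF assms] by simp
  then have "?f -` space borel_M \<inter> space (uniform_measure lborel {0..1}) = UNIV"
    using measurable_space[OF m] by auto
  then show ?thesis
    by (simp add: horocycle_measure_def emeasure_distr[OF m])
qed

lemma fund_domain_sets: "fund_domain \<in> sets liouville"
proof -
  have "fund_domain = T1H \<inter> {v. \<bar>Re (fst v)\<bar> \<le> 1/2 \<and> norm (fst v) \<ge> 1}"
    by (auto simp: fund_domain_def)
  moreover have "closed {v :: complex \<times> complex. \<bar>Re (fst v)\<bar> \<le> 1/2 \<and> norm (fst v) \<ge> 1}"
    by (intro closed_Collect_conj closed_Collect_le continuous_intros)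
  ultimately show ?thesis
    by (auto simp: sets_liouville sets_restrict_space)
qed

lemma cis_measurable: "cis \<in> restrict_space lborel {0..<2*pi} \<rightarrow>\<^sub>M borel"
proof -
  have "cis \<in> borel \<rightarrow>\<^sub>M borel"
    by (rule borel_measurable_continuous_onI) (simp add: continuous_on_cis)
  then show ?thesis by (intro measurable_restrict_space1) simp
qed

lemma emeasure_circle_measure: "emeasure circle_measure {u. norm u = 1} = ennreal (2 * pi)"
proof -
  have "{u :: complex. norm u = 1} \<in> sets borel"
    by (intro borel_closed closed_Collect_eq continuous_intros)
  then show ?thesis
    by (simp add: circle_measure_def emeasure_distr[OF cis_measurable] space_restrict_space
        emeasure_restrict_space)
qed

lemma emeasure_fund_domain:
  "emeasure liouville fund_domain \<noteq> 0" "emeasure liouville fund_domain \<noteq> \<infinity>"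
proof -
  let ?f = "\<lambda>z. ennreal (1 / (Im z)\<^sup>2)"
  let ?D = "density lborel ?f"
  let ?F = "{z. Im z > 0 \<and> \<bar>Re z\<bar> \<le> 1/2 \<and> norm z \<ge> 1}"
  let ?S = "{u :: complex. norm u = 1}"
  have fm: "?f \<in> borel_measurable borel" by measurable
  have S: "?S \<in> sets borel"
    by (intro borel_closed closed_Collect_eq continuous_intros)
  have "?F = {z. Im z > 0} \<inter> {z. \<bar>Re z\<bar> \<le> 1/2 \<and> norm z \<ge> 1}" by auto
  moreover have "open {z. Im z > 0}" by (intro open_Collect_less continuous_intros)
  moreover have "closed {z. \<bar>Re z\<bar> \<le> 1/2 \<and> norm z \<ge> 1}"
    by (intro closed_Collect_conj closed_Collect_le continuous_intros)
  ultimately have F: "?F \<in> sets borel" by auto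
  have "finite_measure circle_measure"
  proof
    have "space circle_measure = UNIV" by (simp add: circle_measure_def)
    moreover have "emeasure circle_measure UNIV = ennreal (2 * pi)"
      by (simp add: circle_measure_def emeasure_distr[OF cis_measurable] space_restrict_space
        emeasure_restrict_space)
    ultimately show "emeasure circle_measure (space circle_measure) \<noteq> \<infinity>" by simp
  qed
  then interpret C: finite_measure circle_measure .
  have T: "T1H = {z. Im z > 0} \<times> ?S" by (auto simp: T1H_def)
  have TS: "T1H \<in> sets (?D \<Otimes>\<^sub>M circle_measure)"
    unfolding T using S \<open>open {z. Im z > 0}\<close>
    by (intro pair_measureI) (auto simp: circle_measure_def)
  have "emeasure liouville fund_domain = emeasure (?D \<Otimes>\<^sub>M circle_measure) (?F \<times> ?S)"
  proof -
    have "fund_domain = ?F \<times> ?S" by (auto simp: fund_domain_def T1H_def)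
    moreover have "fund_domain \<subseteq> T1H" by (auto simp: fund_domain_def)
    ultimately show ?thesis
      unfolding liouville_def using TS by (simp add: emeasure_restrict_space)
  qed
  also have "\<dots> = emeasure ?D ?F * emeasure circle_measure ?S"
    using F S by (intro C.emeasure_pair_measure_Times) (auto simp: circle_measure_def)
  finally have eq: "emeasure liouville fund_domain = emeasure ?D ?F * ennreal (2 * pi)"
    by (simp add: emeasure_circle_measure)

  have content: "emeasure lborel (cbox (Complex a b) (Complex c d)) = ennreal ((c - a) * (d - b))"
    if "a \<le> c" "b \<le> d" for a b c d
    using that by (subst emeasure_lborel_cbox) (auto simp: Basis_complex_def)

  have "emeasure ?D ?F \<noteq> 0"
  proof -
    let ?B = "cbox (Complex (-1/2) 1) (Complex (1/2) 2)"
    have sub: "?B \<subseteq> ?F"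
      by (auto simp: in_cbox_complex_iff) (meson abs_Im_le_cmod abs_ge_self order_trans)
    have "0 < ennreal (1/4) * emeasure lborel ?B" by (simp add: content ennreal_zero_less_mult_iff)
    also have "\<dots> = (\<integral>\<^sup>+z. ennreal (1/4) * indicator ?B z \<partial>lborel)"
      by (simp add: nn_integral_cmult_indicator)
    also have "\<dots> \<le> (\<integral>\<^sup>+z. ?f z * indicator ?F z \<partial>lborel)"
    proof (rule nn_integral_mono)
      fix z show "ennreal (1/4) * indicator ?B z \<le> ?f z * indicator ?F z"
      proof (cases "z \<in> ?B")
        case True
        then have "1 \<le> Im z" "Im z \<le> 2" by (auto simp: in_cbox_complex_iff)
        then have "(Im z)\<^sup>2 \<le> 2\<^sup>2" "(Im z)\<^sup>2 > 0" by (intro power_mono; simp) (use \<open>1 \<le> Im z\<close> in simp)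
        then have "1/4 \<le> 1 / (Im z)\<^sup>2" by (simp add: field_simps)
        then show ?thesis using True sub by (auto simp: indicator_def intro!: ennreal_leI)
      qed simp
    qed
    also have "\<dots> = emeasure ?D ?F" using F fm by (simp add: emeasure_density)
    finally show ?thesis by simp
  qed
  then show "emeasure liouville fund_domain \<noteq> 0" by (simp add: eq)

  define B where "B k = cbox (Complex (-1/2) (2^k / 2)) (Complex (1/2) (2^k))" for k :: nat
  have cov: "?F \<subseteq> (\<Union>k. B k)"
  proof
    fix z assume z: "z \<in> ?F"
    have "1\<^sup>2 \<le> (norm z)\<^sup>2" using z by (intro power_mono) auto
    moreover have "\<bar>Re z\<bar>\<^sup>2 \<le> (1/2)\<^sup>2" using z by (intro power_mono) auto
    ultimately have "(1/2)\<^sup>2 \<le> (Im z)\<^sup>2"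
      using cmod_power2[of z] by (simp add: power_divide)
    then have I: "1/2 \<le> Im z" using z by (intro power2_le_imp_le[of "1/2"]) auto
    obtain n where "Im z < 2 ^ n" using real_arch_pow[of 2 "Im z"] by auto
    then have ex: "\<exists>n. Im z \<le> 2 ^ n" by (meson less_imp_le)
    define k where "k = (LEAST n. Im z \<le> 2 ^ n)"
    have k: "Im z \<le> 2 ^ k" unfolding k_def using ex by (rule LeastI_ex)
    have "2 ^ k / 2 \<le> Im z"
    proof (cases k)
      case (Suc j)
      then have "\<not> Im z \<le> 2 ^ j" unfolding k_def by (metis lessI not_less_Least)
      then show ?thesis by (simp add: Suc)
    qed (use I in simp)
    with k z have "z \<in> B k" by (auto simp: B_def in_cbox_complex_iff)
    then show "z \<in> (\<Union>k. B k)" by blast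
  qed
  have "emeasure ?D (B k) \<le> ennreal (2 * (1/2) ^ k)" for k
  proof -
    have "emeasure ?D (B k) = (\<integral>\<^sup>+z. ?f z * indicator (B k) z \<partial>lborel)"
      using fm by (simp add: emeasure_density B_def)
    also have "\<dots> \<le> (\<integral>\<^sup>+z. ennreal (4 / (2^k)\<^sup>2) * indicator (B k) z \<partial>lborel)"
    proof (rule nn_integral_mono)
      fix z show "?f z * indicator (B k) z \<le> ennreal (4 / (2^k)\<^sup>2) * indicator (B k) z"
      proof (cases "z \<in> B k")
        case True
        then have "2^k / 2 \<le> Im z" by (auto simp: B_def in_cbox_complex_iff)
        then have "(2^k / 2)\<^sup>2 \<le> (Im z)\<^sup>2" by (intro power_mono) auto
        moreover have "(2^k / 2 :: real)\<^sup>2 > 0" by simp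
        ultimately have "1 / (Im z)\<^sup>2 \<le> 1 / (2^k / 2)\<^sup>2"
          by (intro divide_left_mono mult_pos_pos) (linarith | simp)+
        then show ?thesis using True by (auto simp: power_divide intro!: ennreal_leI)
      qed simp
    qed
    also have "\<dots> = ennreal (4 / (2^k)\<^sup>2) * emeasure lborel (B k)"
      by (simp add: nn_integral_cmult_indicator B_def)
    also have "\<dots> = ennreal (4 / (2^k)\<^sup>2) * ennreal (2^k / 2)"
      unfolding B_def by (subst content) auto
    also have "\<dots> = ennreal (4 / (2^k)\<^sup>2 * (2^k / 2))"
      by (subst ennreal_mult) auto
    also have "4 / (2^k)\<^sup>2 * (2^k / 2) = (2 * (1/2) ^ k :: real)"
      by (simp add: power2_eq_square field_simps)
    finally show ?thesis .
  qed
  then have "(\<Sum>k. emeasure ?D (B k)) \<le> (\<Sum>k. ennreal (2 * (1/2) ^ k))"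
    by (intro suminf_le) auto
  also have "\<dots> < \<infinity>"
    by (subst suminf_ennreal2) (auto intro!: summable_mult summable_geometric)
  finally have fin: "(\<Sum>k. emeasure ?D (B k)) < \<infinity>" .
  have "emeasure ?D ?F \<le> emeasure ?D (\<Union>k. B k)"
    by (rule emeasure_mono[OF cov]) (auto simp: B_def)
  also have "\<dots> \<le> (\<Sum>k. emeasure ?D (B k))"
    by (rule emeasure_subadditive_countably) (auto simp: B_def)
  also note fin
  finally show "emeasure liouville fund_domain \<noteq> \<infinity>"
    by (simp add: eq ennreal_mult_eq_top_iff)
qed

lemma emeasure_haar_M: "emeasure haar_M (space haar_M) = 1"
proof -
  let ?U = "uniform_measure liouville fund_domain"
  have m: "proj \<in> ?U \<rightarrow>\<^sub>M borel_M"
    using proj_measurable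
    by (subst measurable_cong_sets[OF _ refl, of _ "restrict_space borel T1H"])
      (simp_all add: sets_liouville)
  have "proj -` space borel_M \<inter> space ?U = space liouville"
    using measurable_space[OF m] by auto
  then have "emeasure haar_M (space haar_M) = emeasure ?U (space liouville)"
    by (simp add: haar_M_def emeasure_distr[OF m])
  also have "\<dots> = 1"
    using fund_domain_sets emeasure_fund_domain sets.sets_into_space[OF fund_domain_sets]
    by (simp add: Int_absorb2 ennreal_divide_self top.not_eq_extremum)
  finally show ?thesis .
qed

end

theory Submission
  imports Defs "HOL-Number_Theory.Cong" "HOL-Real_Asymp.Real_Asymp"
begin

text \<open>The error cannot decay faster than \<open>\<surd>y\<close> because \<open>y \<mapsto> m\<^sub>y(C)\<close> is discontinuous, with jumps of
that order at arbitrarily small \<open>y\<close>, whereas the Haar measure of \<open>C\<close> does not depend on \<open>y\<close>.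
Whatever its value is, the error at a jump or its limit from the right is at least half the jump.

To see the jumps, note that a box is a union of unstable segments of length \<open>l\<close>, so the closed
horocycle crosses it in whole segments, one for each of its meetings with the base, and
\<open>m\<^sub>y(C) = l y N(y)\<close> where \<open>N(y)\<close> is the number of these meetings (\<open>measure_horocycle_box\<close>; the segments
do not overlap because the box is embedded).  A modular matrix \<open>(a, b; c, d)\<close> makes the downward vector
at \<open>t + iy\<close> point upwards exactly when \<open>t = - d / c\<close>, and then moves it to \<open>a / c + i / (c\<^sup>2 y)\<close>
(\<open>act_downward_eq_upward_iff\<close>).  So \<open>N(y)\<close> counts the reduced fractions \<open>a / c\<close> with
\<open>\<alpha>1 \<le> a / c \<le> \<alpha>2\<close> and \<open>\<beta>1 \<le> 1 / (c\<^sup>2 y) \<le> \<beta>2\<close>.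

When \<open>y\<close> increases through \<open>y0 = 1 / (p\<^sup>2 \<beta>1)\<close>, all fractions with denominator \<open>p\<close> leave the base at the
same moment (\<open>levels_drop\<close>, \<open>horocycle_measure_jump\<close>).  For a prime \<open>p\<close> there are at least
\<open>(\<alpha>2 - \<alpha>1) p - 2\<close> of them (\<open>card_feet_prime_ge\<close>), and \<open>p\<close> is proportional to \<open>y0\<close> to the power \<open>- 1/2\<close>, so
the jump is at least of the order of \<open>l y0 (\<alpha>2 - \<alpha>1) p\<close>, that is of \<open>\<surd>y0\<close>.  An error bounded by \<open>K y\<close> to the power \<open>\<alpha> > 1/2\<close>
is too small for this.

All of this presupposes that the box is a Borel set of the quotient, which holds because the box is
the image of a compact set and the modular group acts properly discontinuously
(\<open>proj_image_compact_measurable\<close>).\<close>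

section \<open>Downward and upward vectors\<close>

lemma hplus_hplus:
  assumes "v \<in> T1H"
  shows "hplus s (hplus r v) = hplus (s + r) v"
proof -
  obtain A x y where A: "A \<in> SL2R" "y > 0" "v = act A (tvec (Complex x y) pi)"
    using act_transitive[OF assms] .
  then show ?thesis by (simp add: hplus_act_pi algebra_simps)
qed

lemma hplus_0:
  assumes "v \<in> T1H"
  shows "hplus 0 v = v"
proof -
  obtain A x y where "A \<in> SL2R" "y > 0" "v = act A (tvec (Complex x y) pi)"
    using act_transitive[OF assms] .
  then show ?thesis by (simp add: hplus_act_pi)
qed

lemma hplus_T1H:
  assumes "v \<in> T1H"
  shows "hplus s v \<in> T1H"
proof -
  obtain A x y where "A \<in> SL2R" "y > 0" "v = act A (tvec (Complex x y) pi)"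
    using act_transitive[OF assms] .
  then show ?thesis by (simp add: hplus_act_pi act_T1H tvec_T1H)
qed

text \<open>A matrix with bottom row \<open>(c, d)\<close> turns the downward vector at \<open>t + iy\<close> by \<open>- 2 arg (c (t + iy) + d)\<close>.
The result points upwards exactly when \<open>c (t + iy) + d\<close> is purely imaginary, that is when
\<open>t = - d / c\<close>; then \<open>c (t + iy) + d = i c y\<close>, and
\<open>\<sigma> z = a / c - 1 / (c (c z + d))\<close> gives the base point \<open>a / c + i / (c\<^sup>2 y)\<close>.\<close>

lemma act_downward_eq_upward_iff:
  assumes A: "A \<in> SL2R" and y: "y > 0"
  shows "act A (tvec (Complex t y) pi) = tvec (Complex x' y') 0 \<longleftrightarrow>
    A$2$1 \<noteq> 0 \<and> A$2$1 * t + A$2$2 = 0 \<and> x' = A$1$1 / A$2$1 \<and> y' = 1 / ((A$2$1)\<^sup>2 * y)"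
proof -
  define a b c d where abcd: "a = A$1$1" "b = A$1$2" "c = A$2$1" "d = A$2$2"
  have det: "a * d - b * c = 1" using SL2R_det[OF A] by (simp add: abcd)
  let ?w = "mob_denom A (Complex t y)"
  have w: "?w = Complex (c * t + d) (c * y)"
    by (simp add: mob_denom_def abcd complex_eq_iff)
  have nz: "?w \<noteq> 0" using mob_denom_nz[OF A] y by simp
  have "- cnj ?w / ?w = 1 \<longleftrightarrow> Re ?w = 0"
    using nz by (subst divide_eq_eq) (auto simp: complex_eq_iff)
  then have ang: "- cnj ?w / ?w = 1 \<longleftrightarrow> c * t + d = 0" by (simp add: w)
  have mob: "mob A (Complex t y) = Complex (a / c) (1 / (c\<^sup>2 * y))" and c: "c \<noteq> 0"
    if h: "c * t + d = 0"
  proof -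
    show c: "c \<noteq> 0" using h det by auto
    have t: "a * t + b = - 1 / c"
      using h det c by (simp add: field_simps) algebra
    show "mob A (Complex t y) = Complex (a / c) (1 / (c\<^sup>2 * y))"
    proof -
      have num: "of_real (A$1$1) * Complex t y + of_real (A$1$2) = Complex (- 1 / c) (a * y)"
        using t by (simp add: abcd complex_eq_iff)
      have den: "Complex 0 (c * y) \<noteq> 0" using c y by (simp add: complex_eq_iff)
      show ?thesis
        unfolding mob_def w h num nonzero_divide_eq_eq[OF den]
        using c y by (simp add: complex_eq_iff field_simps power2_eq_square)
    qed
  qed
  have "act A (tvec (Complex t y) pi) = (mob A (Complex t y), - cnj ?w / ?w)"
    using act_eq[OF A, of "Complex t y" "-1"] y by (simp add: tvec_def)
  then have "act A (tvec (Complex t y) pi) = tvec (Complex x' y') 0 \<longleftrightarrow>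
      mob A (Complex t y) = Complex x' y' \<and> c * t + d = 0"
    by (simp only: tvec_def cis_zero prod.inject ang)
  then show ?thesis
    using mob c by (auto simp: abcd)
qed

text \<open>The matrix with rows \<open>(x, -1)\<close> and \<open>(1, 0)\<close> carries the downward vector at \<open>i / y\<close> to the upward
vector at \<open>x + iy\<close>, hence the horizontal horocycle at height \<open>1 / y\<close> to the flow line sought.\<close>

lemma hplus_upward:
  assumes "y > 0"
  shows "hplus s (tvec (Complex x y) 0) =
    (of_real x - of_real y / (of_real s + \<i>), (\<i> - of_real s) / (\<i> + of_real s))"
proof -
  define A :: "real^2^2" where
    "A = (\<chi> i j. if i = 1 then (if j = 1 then x else - 1) else (if j = 1 then 1 else 0))"
  have A: "A$1$1 = x" "A$1$2 = - 1" "A$2$1 = 1" "A$2$2 = 0" by (simp_all add: A_def)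
  have AS: "A \<in> SL2R" by (simp add: SL2R_def det_2 A)
  let ?w = "Complex (s / y) (1 / y)"
  have w: "?w = (of_real s + \<i>) / of_real y"
    by (simp add: complex_eq_iff)
  have "act A (tvec (Complex 0 (1 / y)) pi) = tvec (Complex x y) 0"
    using assms by (subst act_downward_eq_upward_iff[OF AS]) (simp_all add: A)
  then have "hplus s (tvec (Complex x y) 0) = act A (tvec ?w pi)"
    using hplus_act_pi[OF AS, of "1 / y" s 0] assms by simp
  also have "\<dots> = (mob A ?w, - cnj (mob_denom A ?w) / mob_denom A ?w)"
    using act_eq[OF AS, of ?w "-1"] assms by (simp add: tvec_def)
  also have "mob_denom A ?w = ?w" by (simp add: mob_denom_def A)
  also have "mob A ?w = of_real x - of_real y / (of_real s + \<i>)"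
  proof -
    have "?w \<noteq> 0" using assms by (simp add: complex_eq_iff)
    then have "mob A ?w = of_real x - 1 / ?w"
      by (simp add: mob_def mob_denom_def A diff_divide_distrib)
    also have "1 / ?w = of_real y / (of_real s + \<i>)" by (simp add: w)
    finally show ?thesis .
  qed
  also have "- cnj ?w / ?w = (\<i> - of_real s) / (\<i> + of_real s)"
  proof -
    have cancel: "- (a / r) / (b / r) = - a / b" if "r \<noteq> 0" for a b r :: complex
      using that by (cases "b = 0") (simp_all add: field_simps)
    have "cnj ?w = (of_real s - \<i>) / of_real y" by (simp add: complex_eq_iff)
    then have "- cnj ?w / ?w = - (of_real s - \<i>) / (of_real s + \<i>)"
      using assms by (simp only: w cancel of_real_eq_0_iff)
    then show ?thesis by (simp add: add.commute)
  qed
  finally show ?thesis .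
qed

lemma compact_box_lift:
  assumes "\<beta>1 > 0"
  shows "compact (box_lift \<alpha>1 \<alpha>2 \<beta>1 \<beta>2 l)"
proof -
  define f :: "real \<times> real \<times> real \<Rightarrow> complex \<times> complex" where
    "f = (\<lambda>(x, y, s). (of_real x - of_real y / (of_real s + \<i>), (\<i> - of_real s) / (\<i> + of_real s)))"
  have "of_real s + \<i> \<noteq> 0" "\<i> + of_real s \<noteq> 0" for s :: real by (simp_all add: complex_eq_iff)
  then have "continuous_on UNIV f"
    unfolding f_def case_prod_unfold by (intro continuous_intros) auto
  then have "compact (f ` ({\<alpha>1..\<alpha>2} \<times> {\<beta>1..\<beta>2} \<times> {- l/2..l/2}))"
    by (intro compact_continuous_image compact_Times compact_Icc) (auto intro: continuous_on_subset)
  also have "f ` ({\<alpha>1..\<alpha>2} \<times> {\<beta>1..\<beta>2} \<times> {- l/2..l/2}) = box_lift \<alpha>1 \<alpha>2 \<beta>1 \<beta>2 l"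
  proof (rule set_eqI iffI)+
    fix v assume "v \<in> f ` ({\<alpha>1..\<alpha>2} \<times> {\<beta>1..\<beta>2} \<times> {- l/2..l/2})"
    then obtain x y s where v: "v = f (x, y, s)"
      and r: "x \<in> {\<alpha>1..\<alpha>2}" "y \<in> {\<beta>1..\<beta>2}" "s \<in> {- l/2..l/2}" by auto
    have "v = hplus s (tvec (Complex x y) 0)"
      using hplus_upward[of y s x] r assms by (simp add: v f_def)
    moreover have "\<bar>s\<bar> \<le> l / 2" using r(3) unfolding atLeastAtMost_iff by linarith
    ultimately show "v \<in> box_lift \<alpha>1 \<alpha>2 \<beta>1 \<beta>2 l"
      unfolding box_lift_def using r(1,2) unfolding atLeastAtMost_iff by blast
  next
    fix v assume "v \<in> box_lift \<alpha>1 \<alpha>2 \<beta>1 \<beta>2 l"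
    then obtain x y s where v: "v = hplus s (tvec (Complex x y) 0)"
      and r: "\<alpha>1 \<le> x" "x \<le> \<alpha>2" "\<beta>1 \<le> y" "y \<le> \<beta>2" "\<bar>s\<bar> \<le> l / 2"
      unfolding box_lift_def by blast
    have "v = f (x, y, s)" using hplus_upward[of y s x] r assms by (simp add: v f_def)
    moreover have "s \<in> {- l/2..l/2}" using r(5) unfolding atLeastAtMost_iff by linarith
    ultimately show "v \<in> f ` ({\<alpha>1..\<alpha>2} \<times> {\<beta>1..\<beta>2} \<times> {- l/2..l/2})" using r by auto
  qed
  finally show ?thesis .
qed

lemma box_lift_T1H:
  assumes "\<beta>1 > 0"
  shows "box_lift \<alpha>1 \<alpha>2 \<beta>1 \<beta>2 l \<subseteq> T1H"
  using assms by (auto simp: box_lift_def intro!: hplus_T1H tvec_T1H)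

section \<open>Proper discontinuity of the modular group\<close>

lemma SL2Z_SL2R: "A \<in> SL2Z \<Longrightarrow> A \<in> SL2R"
  by (simp add: SL2Z_def)

lemma SL2Z_mult: "A \<in> SL2Z \<Longrightarrow> B \<in> SL2Z \<Longrightarrow> A ** B \<in> SL2Z"
  using SL2R_mult[of A B] by (simp add: SL2Z_def) (simp add: matrix_matrix_mult_def sum_2)

lemma SL2Z_inv:
  assumes "A \<in> SL2Z"
  obtains B where "B \<in> SL2Z" "B ** A = mat 1"
proof -
  define B :: "real^2^2" where
    "B = (\<chi> i j. if i = 1 then (if j = 1 then A$2$2 else - A$1$2) else (if j = 1 then - A$2$1 else A$1$1))"
  have B: "B$1$1 = A$2$2" "B$1$2 = - A$1$2" "B$2$1 = - A$2$1" "B$2$2 = A$1$1" by (simp_all add: B_def)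
  have det: "A$1$1 * A$2$2 - A$1$2 * A$2$1 = 1" using SL2R_det[OF SL2Z_SL2R[OF assms]] .
  have "B \<in> SL2Z"
    unfolding SL2Z_def SL2R_def
    using assms det by (simp add: det_2 B forall_2 mult.commute SL2Z_def)
  moreover have "B ** A = mat 1"
    using det by (simp add: vec_eq_iff forall_2 matrix_matrix_mult_def sum_2 B mat_def algebra_simps)
  ultimately show ?thesis using that by blast
qed

lemma proj_eq_iff:
  assumes v: "v \<in> T1H" and w: "w \<in> T1H"
  shows "proj v = proj w \<longleftrightarrow> (\<exists>A\<in>SL2Z. act A v = w)"
proof
  have "mat 1 \<in> SL2Z" by (simp add: SL2Z_def SL2R_one) (simp add: mat_def)
  then have "w \<in> proj w" unfolding proj_def using act_one by (metis image_eqI)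
  moreover assume "proj v = proj w"
  ultimately have "w \<in> proj v" by simp
  then show "\<exists>A\<in>SL2Z. act A v = w" by (auto simp: proj_def)
next
  have sub: "proj (act A u) \<subseteq> proj u" if "A \<in> SL2Z" "u \<in> T1H" for A u
  proof
    fix z assume "z \<in> proj (act A u)"
    then obtain B where B: "B \<in> SL2Z" "z = act B (act A u)" by (auto simp: proj_def)
    then have "z = act (B ** A) u" using that by (simp add: act_mult SL2Z_SL2R)
    with B(1) show "z \<in> proj u" using SL2Z_mult that by (auto simp: proj_def)
  qed
  assume "\<exists>A\<in>SL2Z. act A v = w"
  then obtain A where A: "A \<in> SL2Z" "act A v = w" by blast
  obtain B where B: "B \<in> SL2Z" "B ** A = mat 1" using SL2Z_inv[OF A(1)] by metis
  have "act B w = v" using act_mult[of B A v] A B v by (simp add: SL2Z_SL2R act_one)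
  then show "proj v = proj w" using sub[OF A(1) v] sub[OF B(1) w] A(2) by auto
qed

lemma finite_bounded_SL2Z: "finite {A \<in> SL2Z. \<forall>i j. \<bar>A$i$j\<bar> \<le> N}"
proof -
  define m :: "real \<times> real \<times> real \<times> real \<Rightarrow> real^2^2" where
    "m = (\<lambda>(a, b, c, d). \<chi> i j. if i = 1 then (if j = 1 then a else b) else (if j = 1 then c else d))"
  let ?K = "{k \<in> \<int>. \<bar>k\<bar> \<le> N}"
  have "{A \<in> SL2Z. \<forall>i j. \<bar>A$i$j\<bar> \<le> N} \<subseteq> m ` (?K \<times> ?K \<times> ?K \<times> ?K)"
  proof
    fix A assume "A \<in> {A \<in> SL2Z. \<forall>i j. \<bar>A$i$j\<bar> \<le> N}"
    then have "A$i$j \<in> ?K" for i j by (auto simp: SL2Z_def)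
    moreover have "A = m (A$1$1, A$1$2, A$2$1, A$2$2)"
      by (simp add: m_def vec_eq_iff forall_2)
    ultimately show "A \<in> m ` (?K \<times> ?K \<times> ?K \<times> ?K)" by blast
  qed
  moreover have "finite (m ` (?K \<times> ?K \<times> ?K \<times> ?K))"
    by (intro finite_imageI finite_cartesian_product finite_abs_int_segment)
  ultimately show ?thesis by (rule finite_subset)
qed

text \<open>Proper discontinuity, quantitatively: if \<open>z\<close> and its image stay in a compact part of the half-plane,
then \<open>\<bar>c z + d\<bar>\<^sup>2 = Im z / Im (\<sigma> z)\<close> is bounded, and so is \<open>a z + b = \<sigma> z (c z + d)\<close>.  Since \<open>Im z\<close> is
bounded below, a bound for \<open>p z + q\<close> bounds the real numbers \<open>p\<close> and \<open>q\<close>.\<close>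

lemma SL2R_entries_bounded:
  assumes A: "A \<in> SL2R" and z: "norm z \<le> R" "Im z \<ge> \<delta>" and w: "norm (mob A z) \<le> R" "Im (mob A z) \<ge> \<delta>"
    and \<delta>: "\<delta> > 0"
  shows "\<bar>A$i$j\<bar> \<le> (R + 1) * (R / \<delta> + 1) * (1 / \<delta> + 1) * (R + 1)"
proof -
  have R: "R \<ge> 0" using z(1) norm_ge_zero order_trans by blast
  have zp: "Im z > 0" using z \<delta> by linarith
  \<comment> \<open>The summand \<open>1\<close> makes \<open>E\<close> a bound for \<open>R / \<delta>\<close> and for its square root alike.\<close>
  define E where "E = R / \<delta> + 1"
  have E: "E \<ge> 1" using R \<delta> by (simp add: E_def)
  let ?j = "mob_denom A z"
  have jnz: "?j \<noteq> 0" by (rule mob_denom_nz[OF A zp])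
  have lin: "\<bar>p\<bar> \<le> B / \<delta>" "\<bar>q\<bar> \<le> B + B / \<delta> * R"
    if "norm (of_real p * z + of_real q) \<le> B" for p q B :: real
  proof -
    have "\<bar>p\<bar> * \<delta> \<le> \<bar>p\<bar> * Im z" using z by (intro mult_left_mono) auto
    also have "\<dots> = \<bar>Im (of_real p * z + of_real q)\<bar>" using zp by (simp add: abs_mult)
    also have "\<dots> \<le> B" using abs_Im_le_cmod that order_trans by blast
    finally show p: "\<bar>p\<bar> \<le> B / \<delta>" using \<delta> by (simp add: field_simps)
    have "norm (of_real p * z) \<le> B / \<delta> * R"
      unfolding norm_mult using p z(1) R by (intro mult_mono) (auto intro: order_trans[OF abs_ge_zero])
    moreover have "\<bar>q\<bar> = norm ((of_real p * z + of_real q) - of_real p * z)" by simp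
    ultimately show "\<bar>q\<bar> \<le> B + B / \<delta> * R"
      using that norm_triangle_ineq4[of "of_real p * z + of_real q" "of_real p * z"] by linarith
  qed
  have "\<delta> \<le> Im z / (norm ?j)\<^sup>2" using w Im_mob[OF A zp] by simp
  then have "\<delta> * (norm ?j)\<^sup>2 \<le> Im z" using jnz by (simp add: field_simps)
  also have "\<dots> \<le> R" using abs_Im_le_cmod[of z] z(1) by linarith
  finally have "(norm ?j)\<^sup>2 \<le> R / \<delta>" using \<delta> by (simp add: field_simps)
  also have "\<dots> \<le> E\<^sup>2" using E self_le_power[of E 2] by (simp add: E_def)
  finally have "(norm ?j)\<^sup>2 \<le> E\<^sup>2" .
  then have j: "norm ?j \<le> E" by (rule power2_le_imp_le) (use E in linarith)
  have num: "norm (of_real (A$1$1) * z + of_real (A$1$2)) \<le> R * E"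
  proof -
    have "of_real (A$1$1) * z + of_real (A$1$2) = mob A z * ?j" using jnz by (simp add: mob_def)
    then show ?thesis
      using mult_mono[OF w(1) j R norm_ge_zero] by (simp only: norm_mult)
  qed
  let ?N = "(R + 1) * E * (1 / \<delta> + 1) * (R + 1)"
  have grow: "B / \<delta> \<le> ?N \<and> B + B / \<delta> * R \<le> ?N" if "B \<le> (R + 1) * E" "B \<ge> 0" for B
  proof -
    have d: "1 / \<delta> > 0" using \<delta> by simp
    have "B / \<delta> = B * (1 / \<delta>) * 1" by simp
    also have "\<dots> \<le> (R + 1) * E * (1 / \<delta> + 1) * (R + 1)"
      using that R E d by (intro mult_mono) auto
    finally have 1: "B / \<delta> \<le> ?N" .
    have "B + B / \<delta> * R \<le> B * (1 / \<delta> + 1) * (R + 1)"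
      using that R \<delta> by (simp add: field_simps)
    also have "\<dots> \<le> ?N"
    proof (rule mult_right_mono[OF mult_right_mono])
      show "B \<le> (R + 1) * E" by (rule that)
    qed (use R d in simp_all)
    finally show ?thesis using 1 by blast
  qed
  have "R * E \<le> (R + 1) * E" "E \<le> (R + 1) * E" "R * E \<ge> 0" using R E by (auto simp: algebra_simps)
  then have g: "R * E / \<delta> \<le> ?N" "R * E + R * E / \<delta> * R \<le> ?N" "E / \<delta> \<le> ?N" "E + E / \<delta> * R \<le> ?N"
    using grow[of "R * E"] grow[of E] E by simp_all
  have "\<bar>A$1$1\<bar> \<le> ?N" "\<bar>A$1$2\<bar> \<le> ?N" "\<bar>A$2$1\<bar> \<le> ?N" "\<bar>A$2$2\<bar> \<le> ?N"
    using order_trans[OF lin(1)[OF num] g(1)] order_trans[OF lin(2)[OF num] g(2)]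
      order_trans[OF lin(1)[OF j[unfolded mob_denom_def]] g(3)]
      order_trans[OF lin(2)[OF j[unfolded mob_denom_def]] g(4)] by blast+
  then have "\<forall>i j. \<bar>A$i$j\<bar> \<le> ?N" unfolding forall_2 by blast
  then show ?thesis unfolding E_def by blast
qed

lemma continuous_on_act:
  assumes A: "A \<in> SL2R"
  shows "continuous_on T1H (act A)"
proof -
  have denom: "continuous_on T1H (\<lambda>v. mob_denom A (fst v))"
    unfolding mob_denom_def by (intro continuous_intros)
  have nz: "mob_denom A (fst v) \<noteq> 0" if "v \<in> T1H" for v
    using that mob_denom_nz[OF A] by (auto simp: T1H_def)
  have "continuous_on T1H (\<lambda>v. (mob A (fst v), snd v * (cnj (mob_denom A (fst v)) / mob_denom A (fst v))))"
    unfolding mob_def by (intro continuous_intros denom) (simp_all add: nz)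
  then show ?thesis
    by (rule continuous_on_eq) (auto simp: T1H_def act_eq[OF A])
qed

text \<open>The full preimage of \<open>proj ` K\<close> is the union of infinitely many compact translates of \<open>K\<close>.  A
sequence in it with a limit in \<open>T1H\<close> stays, up to finitely many terms, in the finitely many translates whose
matrices obey the bound of \<open>SL2R_entries_bounded\<close>, and their union is compact.\<close>

lemma closedin_saturation:
  assumes K: "compact K" "K \<subseteq> T1H"
  shows "closedin (top_of_set T1H) {v \<in> T1H. proj v \<in> proj ` K}"
  unfolding closedin_limpt
proof (intro conjI allI impI)
  fix v assume v: "v islimpt {v \<in> T1H. proj v \<in> proj ` K} \<and> v \<in> T1H"
  then obtain X where X: "\<And>n. X n \<in> T1H" "\<And>n. proj (X n) \<in> proj ` K" "X \<longlonglongrightarrow> v"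
    unfolding islimpt_sequential by auto
  have Imv: "Im (fst v) > 0" using v by (auto simp: T1H_def)
  have "K \<noteq> {}" using X(2) by auto
  moreover have "continuous_on K (\<lambda>u. Im (fst u))" by (intro continuous_intros)
  ultimately obtain k where k: "k \<in> K" "\<And>u. u \<in> K \<Longrightarrow> Im (fst k) \<le> Im (fst u)"
    using continuous_attains_inf[OF K(1)] by blast
  have Imk: "Im (fst k) > 0" using k(1) K(2) by (auto simp: T1H_def)
  obtain r where r: "\<And>u. u \<in> K \<Longrightarrow> norm u \<le> r"
    using compact_imp_bounded[OF K(1)] by (auto simp: bounded_iff)
  define \<delta> where "\<delta> = min (Im (fst k)) (Im (fst v) / 2)"
  define R where "R = max r (norm (fst v) + 1)"
  have \<delta>: "\<delta> > 0" using Imv Imk by (simp add: \<delta>_def)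
  define N where "N = (R + 1) * (R / \<delta> + 1) * (1 / \<delta> + 1) * (R + 1)"
  define F where "F = {A \<in> SL2Z. \<forall>i j. \<bar>A$i$j\<bar> \<le> N}"
  have F: "finite F" unfolding F_def by (rule finite_bounded_SL2Z)
  let ?S = "\<Union>A\<in>F. act A ` K"
  have "compact ?S"
  proof (intro compact_UN F compact_continuous_image K)
    fix A assume "A \<in> F"
    then have "continuous_on T1H (act A)" by (intro continuous_on_act) (auto simp: F_def SL2Z_def)
    then show "continuous_on K (act A)" using K(2) continuous_on_subset by blast
  qed
  then have closed: "closed ?S" by (rule compact_imp_closed)
  have lim: "(\<lambda>n. Im (fst (X n))) \<longlonglongrightarrow> Im (fst v)" "(\<lambda>n. norm (fst (X n))) \<longlonglongrightarrow> norm (fst v)"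
    by (intro tendsto_intros X(3))+
  have "eventually (\<lambda>n. Im (fst (X n)) > Im (fst v) / 2) sequentially"
    using Imv by (intro order_tendstoD(1)[OF lim(1)]) simp
  moreover have "eventually (\<lambda>n. norm (fst (X n)) < norm (fst v) + 1) sequentially"
    by (intro order_tendstoD(2)[OF lim(2)]) simp
  ultimately have "eventually (\<lambda>n. X n \<in> ?S) sequentially"
  proof eventually_elim
    case (elim n)
    obtain u where u: "u \<in> K" "proj u = proj (X n)" using X(2)[of n] by auto
    then obtain A where A: "A \<in> SL2Z" "act A u = X n" using proj_eq_iff X(1) K(2) by blast
    have "norm (fst u) \<le> R" using r[OF u(1)] norm_fst_le[of "fst u" "snd u"] by (simp add: R_def)
    moreover have "Im (fst u) \<ge> \<delta>" using k(2)[OF u(1)] by (simp add: \<delta>_def)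
    moreover have "mob A (fst u) = fst (X n)" by (simp add: act_def flip: A(2))
    ultimately have "\<bar>A$i$j\<bar> \<le> N" for i j
      unfolding N_def using elim \<delta> SL2Z_SL2R[OF A(1)]
      by (intro SL2R_entries_bounded[of A "fst u"]) (auto simp: R_def \<delta>_def)
    then have "A \<in> F" using A by (simp add: F_def)
    moreover have "X n \<in> act A ` K" using A(2) u(1) by (metis image_eqI)
    ultimately show ?case by (rule UN_I)
  qed
  then have "v \<in> ?S" using Lim_in_closed_set[OF closed _ _ X(3)] by simp
  then obtain A u where A: "A \<in> F" and u: "u \<in> K" "v = act A u" by blast
  have "A \<in> SL2Z" using A unfolding F_def by blast
  then have "proj u = proj v" using proj_eq_iff[of u v] u K(2) v by blast
  then show "v \<in> {v \<in> T1H. proj v \<in> proj ` K}" using v u(1) by (metis (mono_tags) image_eqI mem_Collect_eq)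
qed auto

text \<open>A set outside the \<open>\<sigma>\<close>-algebra would have measure \<open>0\<close> by convention, so an adapted box must be shown
to be Borel before its horocycle measure can be computed.\<close>

lemma proj_image_compact_measurable:
  assumes K: "compact K" "K \<subseteq> T1H"
  shows "proj ` K \<in> sets borel_M"
proof -
  let ?G = "{U. U \<subseteq> M_space \<and> openin (top_of_set T1H) {v \<in> T1H. proj v \<in> U}}"
  have G: "?G \<subseteq> Pow M_space" by auto
  have space: "space borel_M = M_space" and sets: "sets borel_M = sigma_sets M_space ?G"
    unfolding borel_M_def using G by (simp_all add: space_measure_of_conv sets_measure_of)
  have "{v \<in> T1H. proj v \<in> M_space - proj ` K} = T1H - {v \<in> T1H. proj v \<in> proj ` K}"
    by (auto simp: M_space_def)
  then have "M_space - proj ` K \<in> ?G"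
    using closedin_saturation[OF K] by (simp add: openin_diff)
  then have "M_space - proj ` K \<in> sets borel_M" unfolding sets by (rule sigma_sets.Basic)
  then have "space borel_M - (M_space - proj ` K) \<in> sets borel_M" by (rule sets.compl_sets)
  moreover have "space borel_M - (M_space - proj ` K) = proj ` K"
    unfolding space using K(2) by (auto simp: M_space_def)
  ultimately show ?thesis by simp
qed

section \<open>The length of a periodic family of intervals\<close>

lemma emeasure_lborel_plus_vimage:
  assumes "A \<in> sets borel"
  shows "emeasure lborel ((+) c -` A) = emeasure lborel (A :: real set)"
proof -
  have "emeasure lborel A = emeasure (distr lborel borel ((+) c)) A"
    by (simp add: lborel_distr_plus)
  also have "\<dots> = emeasure lborel ((+) c -` A)"
    using assms by (simp add: emeasure_distr)
  finally show ?thesis by simp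
qed

text \<open>Cutting \<open>[t - w/2, t + w/2]\<close> along the integers and moving the pieces into \<open>[0, 1)\<close> preserves the total
length, as the translates do not overlap.\<close>

lemma emeasure_periodized_interval:
  fixes t w :: real
  assumes w: "w \<ge> 0"
    and disj: "\<And>x j k. \<bar>x - (t + of_int j)\<bar> \<le> w / 2 \<Longrightarrow> \<bar>x - (t + of_int k)\<bar> \<le> w / 2 \<Longrightarrow> j = k"
  shows "emeasure lborel ({0..<1} \<inter> (\<Union>k::int. {x. \<bar>x - (t + of_int k)\<bar> \<le> w / 2})) = ennreal w"
proof -
  define I where "I k = {x. \<bar>x - (t + of_int k)\<bar> \<le> w / 2}" for k :: int
  define J where "J k = {of_int (- k)..<of_int (- k) + 1} \<inter> {t - w/2..t + w/2}" for k :: int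
  have I: "I k = {t + of_int k - w/2..t + of_int k + w/2}" for k
    unfolding I_def by (rule set_eqI, unfold mem_Collect_eq atLeastAtMost_iff) linarith
  have "emeasure lborel ({0..<1} \<inter> (\<Union>k. I k)) = emeasure lborel (\<Union>k. {0..<1} \<inter> I k)"
    by (simp only: Int_UN_distrib)
  also have "\<dots> = (\<integral>\<^sup>+k. emeasure lborel ({0..<1} \<inter> I k) \<partial>count_space UNIV)"
  proof (rule emeasure_UN_countable)
    show "disjoint_family_on (\<lambda>k. {0..<1} \<inter> I k) UNIV"
      using disj unfolding disjoint_family_on_def I_def by blast
  qed (simp_all add: I)
  also have "\<dots> = (\<integral>\<^sup>+k. emeasure lborel (J k) \<partial>count_space UNIV)"
  proof (rule nn_integral_cong)
    fix k :: int
    have "J k = (+) (of_int k) -` ({0..<1} \<inter> I k)" by (auto simp: J_def I)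
    moreover have "{0..<1} \<inter> I k \<in> sets borel" by (simp add: I)
    ultimately show "emeasure lborel ({0..<1} \<inter> I k) = emeasure lborel (J k)"
      by (simp only: emeasure_lborel_plus_vimage)
  qed
  also have "\<dots> = emeasure lborel (\<Union>k. J k)"
  proof (rule emeasure_UN_countable[symmetric])
    show "disjoint_family_on J UNIV"
      unfolding disjoint_family_on_def
    proof (intro ballI impI)
      fix j k :: int assume "j \<noteq> k"
      then have "j + 1 \<le> k \<or> k + 1 \<le> j" by linarith
      then show "J j \<inter> J k = {}"
      proof
        assume "j + 1 \<le> k"
        then have "real_of_int j + 1 \<le> real_of_int k" by linarith
        then show ?thesis by (auto simp: J_def)
      next
        assume "k + 1 \<le> j"
        then have "real_of_int k + 1 \<le> real_of_int j" by linarith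
        then show ?thesis by (auto simp: J_def)
      qed
    qed
  qed (auto simp: J_def)
  also have "(\<Union>k. J k) = {t - w/2..t + w/2}"
  proof
    show "{t - w/2..t + w/2} \<subseteq> (\<Union>k. J k)"
    proof
      fix x assume "x \<in> {t - w/2..t + w/2}"
      then have "x \<in> J (- \<lfloor>x\<rfloor>)"
        using floor_correct[of x] unfolding J_def by simp
      then show "x \<in> (\<Union>k. J k)" by blast
    qed
  qed (auto simp: J_def)
  also have "emeasure lborel {t - w/2..t + w/2} = ennreal w" using w by simp
  finally show ?thesis by (simp add: I_def)
qed

lemma emeasure_periodic_intervals:
  fixes T :: "real set" and w :: real
  assumes w: "w \<ge> 0"
    and per: "\<And>t k::int. t \<in> T \<Longrightarrow> t + of_int k \<in> T"
    and fin: "finite (T \<inter> {0..<1})"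
    and disj: "\<And>x t t'. t \<in> T \<Longrightarrow> t' \<in> T \<Longrightarrow> \<bar>x - t\<bar> \<le> w / 2 \<Longrightarrow> \<bar>x - t'\<bar> \<le> w / 2 \<Longrightarrow> t = t'"
  shows "emeasure lborel ({0..<1} \<inter> {x. \<exists>t\<in>T. \<bar>x - t\<bar> \<le> w / 2}) =
    ennreal (w * real (card (T \<inter> {0..<1})))"
proof -
  define B where "B t = {0..<1} \<inter> (\<Union>k::int. {x. \<bar>x - (t + of_int k)\<bar> \<le> w / 2})" for t :: real
  have closed: "{x. \<bar>x - s\<bar> \<le> w / 2} \<in> sets borel" for s :: real
    by (intro borel_closed closed_Collect_le continuous_intros)
  have B: "emeasure lborel (B t) = ennreal w" if "t \<in> T" for t
    unfolding B_def
  proof (rule emeasure_periodized_interval[OF w])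
    fix x j k
    assume "\<bar>x - (t + of_int j)\<bar> \<le> w / 2" "\<bar>x - (t + of_int k)\<bar> \<le> w / 2"
    from disj[OF per[OF that] per[OF that] this]
    have "t + of_int j = t + of_int k" .
    then show "j = k" by simp
  qed
  have "{0..<1} \<inter> {x. \<exists>t\<in>T. \<bar>x - t\<bar> \<le> w / 2} = (\<Union>t\<in>T \<inter> {0..<1}. B t)"
  proof (rule set_eqI iffI)+
    fix x assume "x \<in> {0..<1} \<inter> {x. \<exists>t\<in>T. \<bar>x - t\<bar> \<le> w / 2}"
    then obtain t where t: "t \<in> T" "\<bar>x - t\<bar> \<le> w / 2" "x \<in> {0..<1}" by auto
    have "frac t \<in> T" using per[OF t(1), of "- \<lfloor>t\<rfloor>"] by (simp add: frac_def)
    moreover have "frac t + of_int \<lfloor>t\<rfloor> = t" by (simp add: frac_def)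
    ultimately have "\<bar>x - (frac t + of_int \<lfloor>t\<rfloor>)\<bar> \<le> w / 2" using t(2) by metis
    then have "x \<in> B (frac t)" using t(3) unfolding B_def by blast
    with \<open>frac t \<in> T\<close> frac_lt_1[of t] frac_ge_0[of t]
    show "x \<in> (\<Union>t\<in>T \<inter> {0..<1}. B t)" by auto
  next
    fix x assume "x \<in> (\<Union>t\<in>T \<inter> {0..<1}. B t)"
    then show "x \<in> {0..<1} \<inter> {x. \<exists>t\<in>T. \<bar>x - t\<bar> \<le> w / 2}"
      unfolding B_def using per by blast
  qed
  also have "emeasure lborel \<dots> = (\<Sum>t\<in>T \<inter> {0..<1}. emeasure lborel (B t))"
  proof (rule sum_emeasure[symmetric])
    show "B ` (T \<inter> {0..<1}) \<subseteq> sets lborel"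
      using closed by (auto simp: B_def intro!: sets.Int sets.countable_UN)
    show "disjoint_family_on B (T \<inter> {0..<1})"
      unfolding disjoint_family_on_def
    proof (intro ballI impI, rule ccontr)
      fix s t assume st: "s \<in> T \<inter> {0..<1}" "t \<in> T \<inter> {0..<1}" "s \<noteq> t" "B s \<inter> B t \<noteq> {}"
      then obtain x j k where "\<bar>x - (s + of_int j)\<bar> \<le> w / 2" "\<bar>x - (t + of_int k)\<bar> \<le> w / 2"
        unfolding B_def by blast
      from disj[OF per per this] st
      have eq: "s + of_int j = t + of_int k" by blast
      have "\<bar>s - t\<bar> < 1" using st by auto
      with eq have "\<bar>real_of_int (j - k)\<bar> < 1" by simp
      then have "j = k" by linarith
      with eq st show False by simp
    qed
  qed (rule fin)
  also have "\<dots> = ennreal (w * real (card (T \<inter> {0..<1})))"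
    using B w by (simp add: ennreal_mult' ennreal_of_nat_eq_real_of_nat mult.commute)
  finally show ?thesis .
qed

section \<open>Counting reduced fractions\<close>

text \<open>The abscissae at which a horocycle at height \<open>y\<close> meets the stable strip \<open>\<alpha>1 \<le> x \<le> \<alpha>2\<close> through a
modular matrix with lower left entry \<open>c\<close>.  They are the fractions \<open>- d / c\<close> in lowest terms whose
numerator satisfies \<open>a d \<equiv> 1 (mod c)\<close> for some \<open>a\<close> with \<open>a / c \<in> [\<alpha>1, \<alpha>2]\<close>, and do not depend on \<open>y\<close>.\<close>

definition feet :: "real \<Rightarrow> real \<Rightarrow> nat \<Rightarrow> real set" where
  "feet \<alpha>1 \<alpha>2 c = {t. \<exists>a b d::int. a * d - b * int c = 1 \<and> real c * t + of_int d = 0 \<and>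
     \<alpha>1 \<le> of_int a / real c \<and> of_int a / real c \<le> \<alpha>2}"

text \<open>The meeting point belonging to \<open>c\<close> has height \<open>1 / (c\<^sup>2 y)\<close>, so only these denominators contribute to
the box.\<close>

definition levels :: "real \<Rightarrow> real \<Rightarrow> real \<Rightarrow> nat set" where
  "levels \<beta>1 \<beta>2 y = {c. c > 0 \<and> \<beta>1 \<le> 1 / ((real c)\<^sup>2 * y) \<and> 1 / ((real c)\<^sup>2 * y) \<le> \<beta>2}"

lemma feet_add_int:
  assumes "t \<in> feet \<alpha>1 \<alpha>2 c"
  shows "t + of_int k \<in> feet \<alpha>1 \<alpha>2 c"
proof -
  obtain a b d where "a * d - b * int c = 1" "real c * t + of_int d = 0"
     "\<alpha>1 \<le> of_int a / real c" "of_int a / real c \<le> \<alpha>2"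
    using assms by (auto simp: feet_def)
  then have "a * (d - int c * k) - (b - a * k) * int c = 1 \<and>
    real c * (t + of_int k) + of_int (d - int c * k) = 0 \<and>
    \<alpha>1 \<le> of_int a / real c \<and> of_int a / real c \<le> \<alpha>2"
    by (simp add: algebra_simps)
  then show ?thesis unfolding feet_def by blast
qed

lemma finite_feet_period:
  assumes "c > 0"
  shows "finite (feet \<alpha>1 \<alpha>2 c \<inter> {0..<1})"
proof (rule finite_subset)
  show "feet \<alpha>1 \<alpha>2 c \<inter> {0..<1} \<subseteq> (\<lambda>d. - of_int d / real c) ` {- int c..0}"
  proof
    fix t assume "t \<in> feet \<alpha>1 \<alpha>2 c \<inter> {0..<1}"
    then obtain d :: int where d: "real c * t + of_int d = 0" and t: "0 \<le> t" "t < 1"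
      by (auto simp: feet_def)
    have "0 \<le> real c * t" "real c * t \<le> real c * 1"
      using t mult_left_mono[of t 1 "real c"] by simp_all
    with d have "real_of_int (- int c) \<le> of_int d" "real_of_int d \<le> of_int 0" by simp_all
    then have "d \<in> {- int c..0}" unfolding of_int_le_iff by simp
    moreover have "t = - of_int d / real c" using d assms by (simp add: field_simps)
    ultimately show "t \<in> (\<lambda>d. - of_int d / real c) ` {- int c..0}" by blast
  qed
qed simp

text \<open>A fraction in lowest terms determines its denominator.\<close>

lemma feet_disjoint:
  assumes "c > 0" "c' > 0" "t \<in> feet \<alpha>1 \<alpha>2 c" "t \<in> feet \<alpha>1 \<alpha>2 c'"
  shows "c = c'"
proof -
  obtain a b d where d: "a * d - b * int c = 1" "real c * t + of_int d = 0"
    using assms by (auto simp: feet_def)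
  obtain a' b' d' where d': "a' * d' - b' * int c' = 1" "real c' * t + of_int d' = 0"
    using assms by (auto simp: feet_def)
  have "of_int d * real c' = - (real c * real c' * t)" "of_int d' * real c = - (real c * real c' * t)"
    using d(2) d'(2) by algebra+
  then have "real_of_int (d * int c') = real_of_int (d' * int c)" by simp
  then have e: "d * int c' = d' * int c" unfolding of_int_eq_iff .
  have "int c' = int c' * (a * d - b * int c)" "int c = int c * (a' * d' - b' * int c')"
    using d(1) d'(1) by simp_all
  then have "int c' = int c * (a * d' - b * int c')" "int c = int c' * (a' * d - b' * int c)"
    using e by (simp_all add: algebra_simps)
  then have "int c dvd int c'" "int c' dvd int c" by (metis dvd_triv_left)+
  then show ?thesis by (simp add: dvd_antisym)
qed

lemma finite_levels:
  assumes "\<beta>1 > 0" "y > 0"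
  shows "finite (levels \<beta>1 \<beta>2 y)"
proof (rule finite_subset)
  show "levels \<beta>1 \<beta>2 y \<subseteq> {..nat \<lceil>1 / (\<beta>1 * y)\<rceil>}"
  proof
    fix c assume "c \<in> levels \<beta>1 \<beta>2 y"
    then have c: "c > 0" "\<beta>1 \<le> 1 / ((real c)\<^sup>2 * y)" by (auto simp: levels_def)
    then have "(real c)\<^sup>2 \<le> 1 / (\<beta>1 * y)" using assms by (simp add: field_simps)
    moreover have "real c * 1 \<le> real c * real c" using c by (intro mult_left_mono) auto
    ultimately have "real c \<le> 1 / (\<beta>1 * y)" by (simp add: power2_eq_square)
    then show "c \<in> {..nat \<lceil>1 / (\<beta>1 * y)\<rceil>}" by simp linarith
  qed
qed simp

text \<open>At \<open>y = y0\<close> the denominator \<open>p\<close> sits exactly on the lower edge \<open>\<beta>1\<close> of the base and is the largest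
one that contributes; for \<open>y > y0\<close> it has left.  The right-hand side of \<open>y0\<close> is chosen because the
box is closed: a denominator on the upper edge \<open>\<beta>2\<close> at \<open>y0\<close> moves into the box as \<open>y\<close> increases, so it counts on
both sides and cannot compensate the loss of \<open>p\<close>.\<close>

lemma levels_drop:
  assumes \<beta>: "0 < \<beta>1" "\<beta>1 < \<beta>2" and p: "p > 0" and y0: "y0 = 1 / ((real p)\<^sup>2 * \<beta>1)"
  shows "p \<in> levels \<beta>1 \<beta>2 y0"
    and "eventually (\<lambda>y. levels \<beta>1 \<beta>2 y = levels \<beta>1 \<beta>2 y0 - {p}) (at_right y0)"
proof -
  have y0pos: "y0 > 0" using \<beta> p by (simp add: y0)
  have pp: "1 / ((real p)\<^sup>2 * y0) = \<beta>1" using \<beta> p by (simp add: y0)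
  then show "p \<in> levels \<beta>1 \<beta>2 y0" using \<beta> p by (simp add: levels_def)
  have iff: "c \<in> levels \<beta>1 \<beta>2 y \<longleftrightarrow> c > 0 \<and> (real c)\<^sup>2 * y \<le> 1 / \<beta>1 \<and> 1 / \<beta>2 \<le> (real c)\<^sup>2 * y"
    if "y > 0" for y c
    using that \<beta> by (auto simp: levels_def field_simps)
  have low: "c \<in> levels \<beta>1 \<beta>2 y \<Longrightarrow> c \<le> p - 1" if "y > y0" for c y
  proof -
    assume "c \<in> levels \<beta>1 \<beta>2 y"
    then have c: "c > 0" "(real c)\<^sup>2 * y \<le> 1 / \<beta>1" using iff y0pos that by auto
    have "(real c)\<^sup>2 * y0 < (real c)\<^sup>2 * y" using c that by simp
    also have "\<dots> \<le> 1 / \<beta>1" by (rule c)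
    also have "\<dots> = (real p)\<^sup>2 * y0" using pp p y0pos \<beta> by (simp add: y0)
    finally have "(real c)\<^sup>2 < (real p)\<^sup>2" using y0pos by simp
    then show "c \<le> p - 1" using power2_less_imp_less[of "real c" "real p"] by simp
  qed
  have "eventually (\<lambda>y. c \<in> levels \<beta>1 \<beta>2 y \<longleftrightarrow> c \<in> levels \<beta>1 \<beta>2 y0) (at_right y0)"
    if c: "c < p" for c
  proof -
    have t: "((\<lambda>y. (real c)\<^sup>2 * y) \<longlongrightarrow> (real c)\<^sup>2 * y0) (at_right y0)"
      by (intro tendsto_intros)
    have gt: "eventually (\<lambda>y. y > y0) (at_right y0)" by (simp add: eventually_at_filter)
    have "(real c)\<^sup>2 * y0 < (real p)\<^sup>2 * y0"
      using c y0pos by (simp add: power_strict_mono)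
    also have "\<dots> = 1 / \<beta>1" using pp p y0pos \<beta> by (simp add: y0)
    finally have lt: "(real c)\<^sup>2 * y0 < 1 / \<beta>1" .
    have up: "eventually (\<lambda>y. (real c)\<^sup>2 * y < 1 / \<beta>1) (at_right y0)"
      by (rule order_tendstoD(2)[OF t lt])
    show ?thesis
    proof (cases "1 / \<beta>2 \<le> (real c)\<^sup>2 * y0")
      case True
      show ?thesis using gt up
      proof eventually_elim
        case (elim y)
        have "(real c)\<^sup>2 * y0 \<le> (real c)\<^sup>2 * y" using elim by (intro mult_left_mono) auto
        then show ?case using elim True lt y0pos by (auto simp: iff)
      qed
    next
      case False
      then have "eventually (\<lambda>y. (real c)\<^sup>2 * y < 1 / \<beta>2) (at_right y0)"
        by (intro order_tendstoD(2)[OF t]) simp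
      with gt show ?thesis
      proof eventually_elim
        case (elim y)
        then show ?case using False y0pos by (auto simp: iff)
      qed
    qed
  qed
  then have "eventually (\<lambda>y. \<forall>c\<in>{..<p}. c \<in> levels \<beta>1 \<beta>2 y \<longleftrightarrow> c \<in> levels \<beta>1 \<beta>2 y0) (at_right y0)"
    by (intro eventually_ball_finite) auto
  moreover have "eventually (\<lambda>y. y > y0) (at_right y0)" by (simp add: eventually_at_filter)
  ultimately show "eventually (\<lambda>y. levels \<beta>1 \<beta>2 y = levels \<beta>1 \<beta>2 y0 - {p}) (at_right y0)"
  proof eventually_elim
    case (elim y)
    have "c \<le> p" if c: "c \<in> levels \<beta>1 \<beta>2 y0" for c
    proof -
      have "(real c)\<^sup>2 * y0 \<le> 1 / \<beta>1" using iff y0pos c by auto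
      also have "\<dots> = (real p)\<^sup>2 * y0" using pp p y0pos \<beta> by (simp add: y0)
      finally have "(real c)\<^sup>2 \<le> (real p)\<^sup>2" using y0pos by simp
      then show "c \<le> p" using power2_le_imp_le[of "real c" "real p"] by simp
    qed
    moreover have "c < p" if "c \<in> levels \<beta>1 \<beta>2 y" for c
      using low[OF elim(2) that] p by simp
    ultimately show ?case using elim(1) by (fastforce simp: le_less)
  qed
qed

text \<open>For a prime \<open>p\<close> every integer \<open>a\<close> with \<open>\<alpha>1 p \<le> a \<le> \<alpha>2 p\<close> is invertible modulo \<open>p\<close>, except possibly
\<open>a = p\<close>, and its inverse determines it.  The loss \<open>2\<close> accounts for the rounding of the two ends and for \<open>a = p\<close>.\<close>

lemma card_feet_prime_ge:
  assumes p: "prime p" and \<alpha>: "0 < \<alpha>1" "\<alpha>1 < \<alpha>2" "\<alpha>2 \<le> 1"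
  shows "real (card (feet \<alpha>1 \<alpha>2 p \<inter> {0..<1})) \<ge> (\<alpha>2 - \<alpha>1) * real p - 2"
proof -
  have p0: "p > 0" using p by (simp add: prime_gt_0_nat)
  define S where "S = {\<lceil>\<alpha>1 * p\<rceil>..\<lfloor>\<alpha>2 * p\<rfloor>} - {int p}"
  have S: "0 < a" "a < int p" "\<alpha>1 \<le> of_int a / real p" "of_int a / real p \<le> \<alpha>2"
    if a: "a \<in> S" for a
  proof -
    have b: "\<alpha>1 * p \<le> of_int a" "of_int a \<le> \<alpha>2 * p"
      using a by (auto simp: S_def ceiling_le_iff le_floor_iff)
    then show "\<alpha>1 \<le> of_int a / real p" "of_int a / real p \<le> \<alpha>2"
      using p0 by (simp_all add: field_simps)
    have "0 < \<alpha>1 * p" using \<alpha> p0 by simp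
    with b show "0 < a" by linarith
    have "\<alpha>2 * p \<le> 1 * real p" using \<alpha> by (intro mult_right_mono) auto
    with b have "a \<le> int p" by linarith
    with a show "a < int p" by (auto simp: S_def)
  qed
  have "card S \<le> card (feet \<alpha>1 \<alpha>2 p \<inter> {0..<1})"
  proof (rule card_le_if_inj_on_rel
      [where r = "\<lambda>a t. \<exists>d::int. [a * d = 1] (mod int p) \<and> real p * t + of_int d = 0"])
    show "finite (feet \<alpha>1 \<alpha>2 p \<inter> {0..<1})" by (rule finite_feet_period[OF p0])
  next
    fix a assume a: "a \<in> S"
    have "\<not> int p dvd a" using S(1,2)[OF a] zdvd_not_zless by blast
    then have "coprime a (int p)"
      using p by (metis coprime_commute prime_imp_coprime_int prime_nat_int_transfer)
    then obtain x where x: "[a * x = 1] (mod int p)" using cong_solve_coprime_int by blast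
    \<comment> \<open>The inverse of \<open>a\<close> modulo \<open>p\<close> in \<open>(- p, 0]\<close>, so that \<open>- d / p\<close> lies in \<open>[0, 1)\<close>.\<close>
    define d where "d = - ((- x) mod int p)"
    have "[d = - (- x)] (mod int p)"
      unfolding d_def by (rule cong_minus_minus_iff[THEN iffD2]) (simp add: cong_def)
    then have "[a * d = a * x] (mod int p)" by (intro cong_mult cong_refl) simp
    with x have ad: "[a * d = 1] (mod int p)" using cong_trans by blast
    then have "int p dvd a * d - 1" by (simp add: cong_iff_dvd_diff)
    then obtain b where "a * d - 1 = int p * b" by blast
    then have b: "a * d - b * int p = 1" by (simp add: algebra_simps)
    define t where "t = - of_int d / real p"
    have "0 \<le> - d" "- d < int p" using p0 by (simp_all add: d_def)
    then have "0 \<le> real_of_int (- d)" "real_of_int (- d) < real p" by linarith+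
    then have t: "t \<in> {0..<1}" using p0 by (simp add: t_def field_simps)
    have pt: "real p * t + of_int d = 0" using p0 by (simp add: t_def)
    have "t \<in> feet \<alpha>1 \<alpha>2 p" unfolding feet_def using b pt S(3,4)[OF a] by blast
    with t pt ad show "\<exists>t. t \<in> feet \<alpha>1 \<alpha>2 p \<inter> {0..<1} \<and>
        (\<exists>d. [a * d = 1] (mod int p) \<and> real p * t + of_int d = 0)" by blast
  next
    fix a a' t
    assume a: "a \<in> S" "a' \<in> S"
      and "\<exists>d::int. [a * d = 1] (mod int p) \<and> real p * t + of_int d = 0"
      and "\<exists>d::int. [a' * d = 1] (mod int p) \<and> real p * t + of_int d = 0"
    then obtain d d' :: int where d: "[a * d = 1] (mod int p)" "real p * t + of_int d = 0"
      "[a' * d' = 1] (mod int p)" "real p * t + of_int d' = 0" by blast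
    then have [simp]: "d' = d" by linarith
    have "[a * (a' * d') = a * 1] (mod int p)" "[a' * (a * d) = a' * 1] (mod int p)"
      using d unfolding \<open>d' = d\<close> by (blast intro: cong_mult cong_refl)+
    then have "[a = a'] (mod int p)" by (simp add: mult.left_commute) (metis cong_sym cong_trans)
    then show "a = a'" using S(1,2)[OF a(1)] S(1,2)[OF a(2)] by (simp add: cong_def)
  qed
  moreover have "real (card S) \<ge> (\<alpha>2 - \<alpha>1) * real p - 2"
  proof -
    have "int (card {\<lceil>\<alpha>1 * p\<rceil>..\<lfloor>\<alpha>2 * p\<rfloor>}) \<ge> \<lfloor>\<alpha>2 * p\<rfloor> - \<lceil>\<alpha>1 * p\<rceil> + 1" by simp
    moreover have "card S \<ge> card {\<lceil>\<alpha>1 * p\<rceil>..\<lfloor>\<alpha>2 * p\<rfloor>} - card {int p}"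
      unfolding S_def by (rule diff_card_le_card_Diff) simp
    ultimately have "int (card S) \<ge> \<lfloor>\<alpha>2 * p\<rfloor> - \<lceil>\<alpha>1 * p\<rceil>" by simp
    then have "real (card S) \<ge> real_of_int (\<lfloor>\<alpha>2 * p\<rfloor> - \<lceil>\<alpha>1 * p\<rceil>)" by linarith
    then show ?thesis by (simp add: algebra_simps) linarith
  qed
  ultimately show ?thesis by linarith
qed

section \<open>Horocycles crossing a box\<close>

lemma downward_orbit_meets_upward_iff:
  assumes y: "y > 0"
  shows "(\<exists>A\<in>SL2Z. act A (tvec (Complex t y) pi) = tvec (Complex x' y') 0) \<longleftrightarrow>
    (\<exists>c::nat. c > 0 \<and> (\<exists>a b d::int. a * d - b * int c = 1 \<and> real c * t + of_int d = 0 \<and>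
       x' = of_int a / real c) \<and> y' = 1 / ((real c)\<^sup>2 * y))"
    (is "?L \<longleftrightarrow> ?R")
proof
  assume ?L
  then obtain A where A: "A \<in> SL2Z" "act A (tvec (Complex t y) pi) = tvec (Complex x' y') 0" by blast
  have AR: "A \<in> SL2R" by (rule SL2Z_SL2R[OF A(1)])
  have "A$i$j \<in> \<int>" for i j using A(1) by (simp add: SL2Z_def)
  then obtain a b c d :: int where e:
    "A$1$1 = of_int a" "A$1$2 = of_int b" "A$2$1 = of_int c" "A$2$2 = of_int d"
    by (metis Ints_cases)
  have "real_of_int (a * d - b * c) = of_int 1" using SL2R_det[OF AR] by (simp add: e)
  then have det: "a * d - b * c = 1" unfolding of_int_eq_iff .
  have h: "c \<noteq> 0" "of_int c * t + of_int d = 0" "x' = of_int a / of_int c" "y' = 1 / ((of_int c)\<^sup>2 * y)"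
    using A(2) unfolding act_downward_eq_upward_iff[OF AR y] e by simp_all
  show ?R
  proof (cases "c > 0")
    case True
    then have "of_int c = real (nat c)" "c = int (nat c)" by simp_all
    then show ?thesis using h det True by (intro exI[of _ "nat c"]) auto
  next
    \<comment> \<open>The matrices \<open>A\<close> and \<open>- A\<close> act alike, so the lower left entry can be taken positive.\<close>
    case False
    then have c: "of_int c = - real (nat (- c))" "c = - int (nat (- c))" using h by simp_all
    have "(- a) * (- d) - (- b) * int (nat (- c)) = 1" using det False by simp
    moreover have "real (nat (- c)) * t + of_int (- d) = 0" using h(2) unfolding c(1) by simp
    moreover have "x' = of_int (- a) / real (nat (- c))" using h(3) unfolding c(1) by simp
    moreover have "y' = 1 / ((real (nat (- c)))\<^sup>2 * y)" using h(4) unfolding c(1) by simp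
    moreover have "nat (- c) > 0" using False h by simp
    ultimately show ?thesis by blast
  qed
next
  assume ?R
  then obtain c :: nat and a b d :: int where c: "c > 0" and det: "a * d - b * int c = 1"
    and h: "real c * t + of_int d = 0" "x' = of_int a / real c" "y' = 1 / ((real c)\<^sup>2 * y)" by blast
  define A :: "real^2^2" where
    "A = (\<chi> i j. if i = 1 then (if j = 1 then of_int a else of_int b)
                 else (if j = 1 then real c else of_int d))"
  have e: "A$1$1 = of_int a" "A$1$2 = of_int b" "A$2$1 = real c" "A$2$2 = of_int d"
    by (simp_all add: A_def)
  have "real_of_int (a * d - b * int c) = 1" using det by simp
  then have AR: "A \<in> SL2R" by (simp add: SL2R_def det_2 e)
  then have "A \<in> SL2Z" by (simp add: SL2Z_def forall_2 e)
  moreover have "act A (tvec (Complex t y) pi) = tvec (Complex x' y') 0"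
    unfolding act_downward_eq_upward_iff[OF AR y] using c h by (simp add: e)
  ultimately show ?L by blast
qed

text \<open>The flow tilts an upward vector immediately and never brings it back to the vertical; hence the
three coordinates of a box are unique.\<close>

lemma hplus_upward_eq_upward:
  assumes "y > 0" "hplus s (tvec (Complex x y) 0) = tvec (Complex x' y') 0"
  shows "s = 0"
proof -
  have nz: "\<i> + of_real s \<noteq> 0" by (simp add: complex_eq_iff)
  have "(\<i> - of_real s) / (\<i> + of_real s) = 1"
    using assms(2) unfolding hplus_upward[OF assms(1)] by (simp add: tvec_def)
  then have "\<i> - of_real s = \<i> + of_real s" using nz by simp
  then show ?thesis by (simp add: complex_eq_iff)
qed

lemma foot_arc_in_box:
  assumes y: "y > 0" and \<beta>: "\<beta>1 > 0"
    and c: "c \<in> levels \<beta>1 \<beta>2 y" and t: "t \<in> feet \<alpha>1 \<alpha>2 c" "\<bar>x - t\<bar> \<le> l * y / 2"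
  obtains x' y' where "y' > 0"
    and "hplus ((x - t) / y) (tvec (Complex x' y') 0) \<in> box_lift \<alpha>1 \<alpha>2 \<beta>1 \<beta>2 l"
    and "proj (hplus ((x - t) / y) (tvec (Complex x' y') 0)) = proj (tvec (Complex x y) pi)"
proof -
  define s where "s = (x - t) / y"
  define y' where "y' = 1 / ((real c)\<^sup>2 * y)"
  obtain a b d where d: "a * d - b * int c = 1" "real c * t + of_int d = 0"
    "\<alpha>1 \<le> of_int a / real c" "of_int a / real c \<le> \<alpha>2"
    using t(1) unfolding feet_def by blast
  have y': "\<beta>1 \<le> y'" "y' \<le> \<beta>2" "c > 0" using c by (simp_all add: levels_def y'_def)
  have "\<exists>A\<in>SL2Z. act A (tvec (Complex t y) pi) = tvec (Complex (of_int a / real c) y') 0"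
    unfolding downward_orbit_meets_upward_iff[OF y] using d(1,2) y'(3) y'_def by blast
  then obtain A where A: "A \<in> SL2Z" "act A (tvec (Complex t y) pi) = tvec (Complex (of_int a / real c) y') 0"
    by blast
  have "act A (tvec (Complex x y) pi) = hplus s (act A (tvec (Complex t y) pi))"
    using hplus_act_pi[OF SL2Z_SL2R[OF A(1)] y, of s t] y by (simp add: s_def)
  then have "act A (tvec (Complex x y) pi) = hplus s (tvec (Complex (of_int a / real c) y') 0)"
    by (simp add: A(2))
  moreover have "\<bar>s\<bar> \<le> l / 2" using t(2) y by (simp add: s_def field_simps)
  then have b: "hplus s (tvec (Complex (of_int a / real c) y') 0) \<in> box_lift \<alpha>1 \<alpha>2 \<beta>1 \<beta>2 l"
    unfolding box_lift_def using d y' by blast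
  moreover have "hplus s (tvec (Complex (of_int a / real c) y') 0) \<in> T1H"
    using b box_lift_T1H[OF \<beta>] by blast
  ultimately have "proj (hplus s (tvec (Complex (of_int a / real c) y') 0)) = proj (tvec (Complex x y) pi)"
    using A(1) proj_eq_iff[OF tvec_T1H[OF y]] by metis
  then show ?thesis using that[of y'] b y' \<beta> unfolding s_def by (meson less_le_trans)
qed

text \<open>A box is a union of flow segments of length \<open>l\<close> centred on its base.  Along the horocycle at
height \<open>y\<close>, flow time \<open>s\<close> shifts the parameter \<open>x\<close> by \<open>s y\<close>, so the horocycle runs through the box exactly within parameter distance
\<open>l y / 2\<close> of its meetings with the base.\<close>

lemma horocycle_in_box_iff:
  assumes y: "y > 0" and \<beta>: "\<beta>1 > 0"
  shows "proj (tvec (Complex x y) pi) \<in> proj ` box_lift \<alpha>1 \<alpha>2 \<beta>1 \<beta>2 l \<longleftrightarrow>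
    (\<exists>t\<in>(\<Union>c\<in>levels \<beta>1 \<beta>2 y. feet \<alpha>1 \<alpha>2 c). \<bar>x - t\<bar> \<le> l * y / 2)"
    (is "?L \<longleftrightarrow> ?R")
proof
  assume ?L
  then obtain x' y' s where r: "\<alpha>1 \<le> x'" "x' \<le> \<alpha>2" "\<beta>1 \<le> y'" "y' \<le> \<beta>2" "\<bar>s\<bar> \<le> l / 2"
    and e: "proj (tvec (Complex x y) pi) = proj (hplus s (tvec (Complex x' y') 0))"
    by (auto simp: box_lift_def)
  have q: "tvec (Complex x' y') 0 \<in> T1H" using r \<beta> by (intro tvec_T1H) simp
  obtain A where A: "A \<in> SL2Z" "act A (tvec (Complex x y) pi) = hplus s (tvec (Complex x' y') 0)"
    using e proj_eq_iff[OF tvec_T1H[OF y] hplus_T1H[OF q]] by blast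
  have "act A (tvec (Complex (x - s * y) y) pi) = hplus (- s) (act A (tvec (Complex x y) pi))"
    using hplus_act_pi[OF SL2Z_SL2R[OF A(1)] y, of "- s" x] by simp
  also have "\<dots> = tvec (Complex x' y') 0"
    using hplus_hplus[OF q, of "- s" s] hplus_0[OF q] by (simp add: A(2))
  finally obtain c a b d where c: "c > 0" "y' = 1 / ((real c)\<^sup>2 * y)" and
    "a * d - b * int c = 1" "real c * (x - s * y) + of_int d = 0" "x' = of_int a / real c"
    using downward_orbit_meets_upward_iff[OF y] A(1) by blast
  then have "x - s * y \<in> feet \<alpha>1 \<alpha>2 c" using r unfolding feet_def by blast
  moreover have "c \<in> levels \<beta>1 \<beta>2 y" using c r by (simp add: levels_def)
  moreover have "\<bar>x - (x - s * y)\<bar> \<le> l * y / 2"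
    using mult_right_mono[OF r(5), of y] y by (simp add: abs_mult)
  ultimately show ?R by blast
next
  assume ?R
  then obtain t c where c: "c \<in> levels \<beta>1 \<beta>2 y" and t: "t \<in> feet \<alpha>1 \<alpha>2 c" "\<bar>x - t\<bar> \<le> l * y / 2" by blast
  show ?L using foot_arc_in_box[OF y \<beta> c t] by (metis image_eqI)
qed

text \<open>A common point of two arcs would have two sets of coordinates in the embedded box.\<close>

lemma feet_arcs_disjoint:
  assumes y: "y > 0" and \<beta>: "\<beta>1 > 0" and inj: "inj_on proj (box_lift \<alpha>1 \<alpha>2 \<beta>1 \<beta>2 l)"
    and t: "t \<in> feet \<alpha>1 \<alpha>2 c" "c \<in> levels \<beta>1 \<beta>2 y" "\<bar>x - t\<bar> \<le> l * y / 2"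
    and t': "t' \<in> feet \<alpha>1 \<alpha>2 c'" "c' \<in> levels \<beta>1 \<beta>2 y" "\<bar>x - t'\<bar> \<le> l * y / 2"
  shows "t = t'"
proof -
  obtain q1 q2 where q: "q2 > 0"
    "hplus ((x - t) / y) (tvec (Complex q1 q2) 0) \<in> box_lift \<alpha>1 \<alpha>2 \<beta>1 \<beta>2 l"
    "proj (hplus ((x - t) / y) (tvec (Complex q1 q2) 0)) = proj (tvec (Complex x y) pi)"
    by (rule foot_arc_in_box[OF y \<beta> t(2,1,3)])
  obtain r1 r2 where r: "r2 > 0"
    "hplus ((x - t') / y) (tvec (Complex r1 r2) 0) \<in> box_lift \<alpha>1 \<alpha>2 \<beta>1 \<beta>2 l"
    "proj (hplus ((x - t') / y) (tvec (Complex r1 r2) 0)) = proj (tvec (Complex x y) pi)"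
    by (rule foot_arc_in_box[OF y \<beta> t'(2,1,3)])
  define s s' where "s = (x - t) / y" and "s' = (x - t') / y"
  have qT: "tvec (Complex q1 q2) 0 \<in> T1H" and rT: "tvec (Complex r1 r2) 0 \<in> T1H"
    using q(1) r(1) by (simp_all add: tvec_T1H)
  have "hplus s (tvec (Complex q1 q2) 0) = hplus s' (tvec (Complex r1 r2) 0)"
    unfolding s_def s'_def using inj_onD[OF inj _ q(2) r(2)] q(3) r(3) by simp
  then have "hplus (- s') (hplus s (tvec (Complex q1 q2) 0)) = hplus (- s') (hplus s' (tvec (Complex r1 r2) 0))"
    by simp
  then have "hplus (- s' + s) (tvec (Complex q1 q2) 0) = tvec (Complex r1 r2) 0"
    by (simp add: hplus_hplus qT rT hplus_0)
  then have "- s' + s = 0" by (rule hplus_upward_eq_upward[OF q(1)])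
  then show ?thesis using y by (simp add: s_def s'_def field_simps)
qed

text \<open>Each of the finitely many meetings with the base contributes one arc of normalized length \<open>l y\<close>.\<close>

lemma measure_horocycle_box:
  assumes y: "y > 0" and \<beta>: "\<beta>1 > 0" and l: "l > 0" and inj: "inj_on proj (box_lift \<alpha>1 \<alpha>2 \<beta>1 \<beta>2 l)"
  shows "measure (horocycle_measure y) (proj ` box_lift \<alpha>1 \<alpha>2 \<beta>1 \<beta>2 l) =
    l * y * real (\<Sum>c\<in>levels \<beta>1 \<beta>2 y. card (feet \<alpha>1 \<alpha>2 c \<inter> {0..<1}))"
proof -
  define C where "C = proj ` box_lift \<alpha>1 \<alpha>2 \<beta>1 \<beta>2 l"
  define T where "T = (\<Union>c\<in>levels \<beta>1 \<beta>2 y. feet \<alpha>1 \<alpha>2 c)"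
  define S where "S = {x. \<exists>t\<in>T. \<bar>x - t\<bar> \<le> l * y / 2}"
  let ?f = "\<lambda>x. proj (tvec (Complex x y) pi)"
  have fin: "finite (levels \<beta>1 \<beta>2 y)" by (rule finite_levels[OF \<beta> y])
  have pos: "c > 0" if "c \<in> levels \<beta>1 \<beta>2 y" for c using that by (simp add: levels_def)
  have T: "T \<inter> {0..<1} = (\<Union>c\<in>levels \<beta>1 \<beta>2 y. feet \<alpha>1 \<alpha>2 c \<inter> {0..<1})" by (auto simp: T_def)
  have cardT: "card (T \<inter> {0..<1}) = (\<Sum>c\<in>levels \<beta>1 \<beta>2 y. card (feet \<alpha>1 \<alpha>2 c \<inter> {0..<1}))"
    unfolding T
  proof (rule card_UN_disjoint[OF fin])
    show "\<forall>c\<in>levels \<beta>1 \<beta>2 y. finite (feet \<alpha>1 \<alpha>2 c \<inter> {0..<1})"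
      using finite_feet_period pos by blast
    show "\<forall>c\<in>levels \<beta>1 \<beta>2 y. \<forall>c'\<in>levels \<beta>1 \<beta>2 y. c \<noteq> c' \<longrightarrow>
        feet \<alpha>1 \<alpha>2 c \<inter> {0..<1} \<inter> (feet \<alpha>1 \<alpha>2 c' \<inter> {0..<1}) = {}"
      using feet_disjoint pos by blast
  qed
  have finT: "finite (T \<inter> {0..<1})"
    unfolding T using fin finite_feet_period pos by blast
  have m: "?f \<in> uniform_measure lborel {0..1} \<rightarrow>\<^sub>M borel_M"
    using proj_tvec_measurable[OF y] by simp
  have C: "C \<in> sets borel_M"
    unfolding C_def by (rule proj_image_compact_measurable[OF compact_box_lift[OF \<beta>] box_lift_T1H[OF \<beta>]])
  have pre: "?f -` C \<inter> space (uniform_measure lborel {0..1}) = S"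
    by (rule set_eqI) (simp add: S_def T_def C_def horocycle_in_box_iff[OF y \<beta>])
  have S: "S \<in> sets borel" using measurable_sets[OF m C] unfolding pre by simp
  have "emeasure (horocycle_measure y) C = emeasure (uniform_measure lborel {0..1}) S"
    unfolding horocycle_measure_def emeasure_distr[OF m C] pre ..
  also have "\<dots> = emeasure lborel ({0..1} \<inter> S)"
    using S by (simp add: divide_ennreal_def)
  also have "\<dots> = emeasure lborel ({0..<1} \<inter> S)"
  proof (rule emeasure_eq_AE)
    show "AE x in lborel. x \<in> {0..1} \<inter> S \<longleftrightarrow> x \<in> {0..<1} \<inter> S"
      using AE_lborel_singleton[of "1::real"] by eventually_elim auto
  qed (use S in simp_all)
  also have "\<dots> = ennreal (l * y * real (card (T \<inter> {0..<1})))"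
    unfolding S_def
  proof (rule emeasure_periodic_intervals[OF _ _ finT])
    show "t + of_int k \<in> T" if "t \<in> T" for t k
      using that feet_add_int unfolding T_def by blast
    show "t = t'" if "t \<in> T" "t' \<in> T" "\<bar>x - t\<bar> \<le> l * y / 2" "\<bar>x - t'\<bar> \<le> l * y / 2" for x t t'
      using that feet_arcs_disjoint[OF y \<beta> inj] unfolding T_def by blast
  qed (use l y in simp)
  finally have "emeasure (horocycle_measure y) C = ennreal (l * y * real (card (T \<inter> {0..<1})))" .
  then have "measure (horocycle_measure y) C = l * y * real (card (T \<inter> {0..<1}))"
    by (rule measure_eq_emeasure_eq_ennreal[rotated]) (use l y in simp)
  then show ?thesis unfolding C_def cardT .
qed

text \<open>The measure is \<open>l y\<close> times an integer-valued function of \<open>y\<close>, and this integer drops by the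
number of feet per period with denominator \<open>p\<close> immediately to the right of \<open>y0\<close>.\<close>

lemma horocycle_measure_jump:
  assumes \<beta>: "0 < \<beta>1" "\<beta>1 < \<beta>2" and l: "l > 0" and inj: "inj_on proj (box_lift \<alpha>1 \<alpha>2 \<beta>1 \<beta>2 l)"
    and p: "p > 0" and y0: "y0 = 1 / ((real p)\<^sup>2 * \<beta>1)"
  shows "((\<lambda>y. measure (horocycle_measure y) (proj ` box_lift \<alpha>1 \<alpha>2 \<beta>1 \<beta>2 l)) \<longlongrightarrow>
    measure (horocycle_measure y0) (proj ` box_lift \<alpha>1 \<alpha>2 \<beta>1 \<beta>2 l)
      - l * y0 * real (card (feet \<alpha>1 \<alpha>2 p \<inter> {0..<1}))) (at_right y0)"
proof -
  define n where "n c = card (feet \<alpha>1 \<alpha>2 c \<inter> {0..<1})" for c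
  define N where "N = real (\<Sum>c\<in>levels \<beta>1 \<beta>2 y0. n c)"
  have y0pos: "y0 > 0" using p \<beta> by (simp add: y0)
  note meas = measure_horocycle_box[OF _ \<beta>(1) l inj, folded n_def]
  have at_y0: "measure (horocycle_measure y0) (proj ` box_lift \<alpha>1 \<alpha>2 \<beta>1 \<beta>2 l) = l * y0 * N"
    using meas[OF y0pos] by (simp add: N_def)
  have rest: "real (\<Sum>c\<in>levels \<beta>1 \<beta>2 y0 - {p}. n c) = N - real (n p)"
    unfolding N_def sum.remove[OF finite_levels[OF \<beta>(1) y0pos] levels_drop(1)[OF \<beta> p y0]] by simp
  have "eventually (\<lambda>y. l * y * (N - real (n p)) =
      measure (horocycle_measure y) (proj ` box_lift \<alpha>1 \<alpha>2 \<beta>1 \<beta>2 l)) (at_right y0)"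
    using levels_drop(2)[OF \<beta> p y0] eventually_at_right_less
  proof eventually_elim
    case (elim y)
    then have "y > 0" using y0pos by simp
    show ?case unfolding meas[OF \<open>y > 0\<close>] elim(1) rest ..
  qed
  moreover have "((\<lambda>y. l * y * (N - real (n p))) \<longlongrightarrow> l * y0 * (N - real (n p))) (at_right y0)"
    by (intro tendsto_intros)
  ultimately have "((\<lambda>y. measure (horocycle_measure y) (proj ` box_lift \<alpha>1 \<alpha>2 \<beta>1 \<beta>2 l)) \<longlongrightarrow>
      l * y0 * (N - real (n p))) (at_right y0)"
    by (rule Lim_transform_eventually[rotated])
  then show ?thesis unfolding at_y0 by (simp add: n_def algebra_simps)
qed

section \<open>The jumps bound the error from below\<close>

theorem theorem4p20:
  fixes C :: "(complex \<times> complex) set set" and \<alpha> :: real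
  assumes "adapted_box C" and "\<alpha> > 1/2"
  shows "Limsup (at_right 0)
           (\<lambda>y. ereal (\<bar>measure (horocycle_measure y) C - measure haar_M C\<bar> * y powr (- \<alpha>))) = \<infinity>"
proof (rule ccontr)
  let ?F = "\<lambda>y. ereal (\<bar>measure (horocycle_measure y) C - measure haar_M C\<bar> * y powr (- \<alpha>))"
  assume "Limsup (at_right 0) ?F \<noteq> \<infinity>"
  then have "Limsup (at_right 0) ?F < \<infinity>" by simp
  then obtain K where "Limsup (at_right 0) ?F < ereal K"
    using ereal_dense2 by blast
  then have "eventually (\<lambda>y. ?F y < ereal K) (at_right 0)" by (rule Limsup_lessD)
  then obtain \<delta> where \<delta>: "\<delta> > 0" "\<And>y. 0 < y \<Longrightarrow> y < \<delta> \<Longrightarrow> ?F y < ereal K"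
    unfolding eventually_at_right_field by blast
  have bound: "\<bar>measure (horocycle_measure y) C - measure haar_M C\<bar> \<le> K * y powr \<alpha>"
    if "0 < y" "y < \<delta>" for y
    using \<delta>(2)[OF that] that by (simp add: powr_minus field_simps)
  obtain \<alpha>1 \<alpha>2 \<beta>1 \<beta>2 l where \<alpha>: "0 < \<alpha>1" "\<alpha>1 < \<alpha>2" "\<alpha>2 \<le> 1" and \<beta>: "0 < \<beta>1" "\<beta>1 < \<beta>2" and l: "l > 0"
    and inj: "inj_on proj (box_lift \<alpha>1 \<alpha>2 \<beta>1 \<beta>2 l)" and C: "C = proj ` box_lift \<alpha>1 \<alpha>2 \<beta>1 \<beta>2 l"
    using assms(1) unfolding adapted_box_def by blast
  define n where "n c = card (feet \<alpha>1 \<alpha>2 c \<inter> {0..<1})" for c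
  \<comment> \<open>The error bound holds at \<open>y0\<close> and, by continuity of the bound, for the limit from the right.\<close>
  have jump: "l * y0 * real (n p) \<le> 2 * K * y0 powr \<alpha>"
    if p: "p > 0" and y0: "y0 = 1 / ((real p)\<^sup>2 * \<beta>1)" and small: "y0 < \<delta>" for p y0
  proof -
    have y0pos: "y0 > 0" using p \<beta> by (simp add: y0)
    let ?m = "\<lambda>y. measure (horocycle_measure y) C"
    have "eventually (\<lambda>y. \<bar>?m y - measure haar_M C\<bar> \<le> K * y powr \<alpha>) (at_right y0)"
      using eventually_at_right_less eventually_at_right_real[OF small]
      by eventually_elim (use bound y0pos in auto)
    moreover have "((\<lambda>y. \<bar>?m y - measure haar_M C\<bar>) \<longlongrightarrow>
        \<bar>?m y0 - l * y0 * real (n p) - measure haar_M C\<bar>) (at_right y0)"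
      unfolding C n_def by (intro tendsto_intros horocycle_measure_jump[OF \<beta> l inj p y0])
    moreover have "((\<lambda>y. K * y powr \<alpha>) \<longlongrightarrow> K * y0 powr \<alpha>) (at_right y0)"
      by (intro tendsto_intros) (use y0pos in simp)
    ultimately have "\<bar>?m y0 - l * y0 * real (n p) - measure haar_M C\<bar> \<le> K * y0 powr \<alpha>"
      using tendsto_le[OF trivial_limit_at_right_real] by blast
    then show ?thesis using bound[OF y0pos small] by linarith
  qed
  \<comment> \<open>The inequality \<open>jump\<close> forces \<open>real p powr (2 * \<alpha> - 1) \<le> D\<close> for all large primes \<open>p\<close>.\<close>
  define D where "D = 4 * K * \<beta>1 powr (1 - \<alpha>) / (l * (\<alpha>2 - \<alpha>1))"
  have large: "eventually (\<lambda>p. 1 / ((real p)\<^sup>2 * \<beta>1) < \<delta>) sequentially"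
    "eventually (\<lambda>p. (\<alpha>2 - \<alpha>1) * real p \<ge> 4) sequentially"
    "eventually (\<lambda>p. real p powr (2 * \<alpha> - 1) > D) sequentially"
  proof -
    show "eventually (\<lambda>p. 1 / ((real p)\<^sup>2 * \<beta>1) < \<delta>) sequentially"
      using \<delta>(1) \<beta> by real_asymp
    show "eventually (\<lambda>p. (\<alpha>2 - \<alpha>1) * real p \<ge> 4) sequentially"
      using \<alpha> by real_asymp
    show "eventually (\<lambda>p. real p powr (2 * \<alpha> - 1) > D) sequentially"
      using assms(2) by real_asymp
  qed
  obtain m where m: "\<And>p. p \<ge> m \<Longrightarrow> 1 / ((real p)\<^sup>2 * \<beta>1) < \<delta> \<and> (\<alpha>2 - \<alpha>1) * real p \<ge> 4 \<and>
      real p powr (2 * \<alpha> - 1) > D"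
    using eventually_conj[OF large(1) eventually_conj[OF large(2,3)]] unfolding eventually_sequentially by blast
  obtain p where p: "prime p" "p > m" using bigger_prime by blast
  have p0: "p > 0" using p by simp
  define y0 where "y0 = 1 / ((real p)\<^sup>2 * \<beta>1)"
  have mp: "y0 < \<delta>" "(\<alpha>2 - \<alpha>1) * real p \<ge> 4" "real p powr (2 * \<alpha> - 1) > D"
    using m[of p] p(2) by (simp_all add: y0_def)
  have y0pos: "y0 > 0" using p0 \<beta> by (simp add: y0_def)
  \<comment> \<open>\<open>(\<alpha>2 - \<alpha>1) * real p \<ge> 4\<close> makes the loss \<open>2\<close> at most half of the main term.\<close>
  have "(\<alpha>2 - \<alpha>1) * real p / 2 \<le> real (n p)"
    using card_feet_prime_ge[OF p(1) \<alpha>] mp(2) unfolding n_def by linarith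
  then have "l * y0 * ((\<alpha>2 - \<alpha>1) * real p / 2) \<le> l * y0 * real (n p)"
    using l y0pos by (intro mult_left_mono) auto
  also have "\<dots> \<le> 2 * K * y0 powr \<alpha>" by (rule jump[OF p0 y0_def mp(1)])
  finally have "l * (\<alpha>2 - \<alpha>1) * (y0 * real p) \<le> 4 * K * y0 powr \<alpha>" by (simp add: algebra_simps)
  moreover have "y0 powr \<alpha> = real p powr (- 2 * \<alpha>) * \<beta>1 powr (- \<alpha>)"
    using p0 \<beta> by (simp add: y0_def powr_divide powr_mult powr_powr powr_minus divide_simps flip: powr_numeral)
  moreover have "y0 * real p = real p powr (- 1) * \<beta>1 powr (- 1)"
    using p0 \<beta> by (simp add: y0_def powr_minus field_simps power2_eq_square)
  ultimately have "l * (\<alpha>2 - \<alpha>1) * (real p powr (- 1) * \<beta>1 powr (- 1)) \<le>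
      4 * K * (real p powr (- 2 * \<alpha>) * \<beta>1 powr (- \<alpha>))" by simp
  then have "l * (\<alpha>2 - \<alpha>1) * (real p powr (- 1) * \<beta>1 powr (- 1)) * (real p powr (2 * \<alpha>) * \<beta>1) \<le>
      4 * K * (real p powr (- 2 * \<alpha>) * \<beta>1 powr (- \<alpha>)) * (real p powr (2 * \<alpha>) * \<beta>1)"
    by (rule mult_right_mono) (use \<beta> in simp)
  then have "l * (\<alpha>2 - \<alpha>1) * ((real p powr (- 1) * real p powr (2 * \<alpha>)) * (\<beta>1 powr (- 1) * \<beta>1)) \<le>
      4 * K * ((real p powr (- 2 * \<alpha>) * real p powr (2 * \<alpha>)) * (\<beta>1 powr (- \<alpha>) * \<beta>1))"
    by (simp only: mult_ac)
  moreover have "real p powr (- 1) * real p powr (2 * \<alpha>) = real p powr (2 * \<alpha> - 1)"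
    "real p powr (- 2 * \<alpha>) * real p powr (2 * \<alpha>) = 1"
    using p0 by (simp_all add: powr_diff powr_minus field_simps)
  moreover have "\<beta>1 powr (- 1) * \<beta>1 = 1" "\<beta>1 powr (- \<alpha>) * \<beta>1 = \<beta>1 powr (1 - \<alpha>)"
    using \<beta> by (simp_all add: powr_minus powr_diff divide_inverse mult.commute)
  ultimately have "l * (\<alpha>2 - \<alpha>1) * real p powr (2 * \<alpha> - 1) \<le> 4 * K * \<beta>1 powr (1 - \<alpha>)"
    by (simp only: mult_1_right mult_1_left)
  then have "real p powr (2 * \<alpha> - 1) \<le> D"
    using l \<alpha> by (simp add: D_def field_simps)
  with mp(3) show False by simp
qed

end
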